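(* Let $k$ be a field, let $m\geq 6$, let $S'=k[a_i,b_i,c_i,d]_{i=1}^m$ be a polynomial ring in $n=3m+1$ variables, with indices read modulo $m$, and let $F'$ be the element of the divided power ring $P$ associated to $S'$ that is dual to the polynomial $$\sum_{i=1}^m \left(a_ib_ic_i + a_ia_{i+1}^2 + b_ib_{i+1}^2 + c_ic_{i+1}^2 + a_ib_{i+1}d\right).$$ Then the apolar algebra $\mathrm{Apolar}(F')=S'/\mathrm{Ann}(F')$ satisfies the small tangent space condition.
   Context: Write $S=S'$. $P$ is the $k$-vector space with basis consisting of symbols $\mu^{*}$, one for each monomial $\mu$ of $S$ (the dual basis to the monomials of $S$), with $\deg\mu^*=\deg\mu$. $S$ acts on $P$ by contraction: for monomials $\nu,\mu$, $\nu\cdot\mu^{*}=(\mu/\nu)^{*}$ if $\nu$ divides $\mu$, and $0$ otherwise. The element of $P$ dual to a polynomial $\sum_\mu c_\mu\mu$ is $\sum_\mu c_\mu\mu^{*}$. For $f\in P$, $\mathrm{Ann}(f)=\{s\in S : s\cdot f=0\}$. For a graded $S$-module $M$ write $H(M)_i=\dim_k M_i$ ($S$ has the standard grading). "$M$ has Hilbert function $(h_0,\dots,h_j)$" means $H(M)_i=h_i$ for $0\le i\le j$ and $H(M)_i=0$ otherwise. Small tangent space condition ($n$ = number of variables of $S$): for $f\in P$ homogeneous of degree $3$ and $I=\mathrm{Ann}(f)$, $\mathrm{Apolar}(f)$ satisfies it if $S/I$ has Hilbert function $(1,n,n,1)$, $H(S/I^2)_4=n$ and $H(S/I^2)_5=0$.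 *)

theory Defs
  imports "HOL-Library.Poly_Mapping" "HOL-Algebra.Algebra"
begin

section \<open>Polynomials in a set of variables\<close>

text \<open>
  A monomial is the finitely supported family of its exponents (so the product of monomials is
  \<open>+\<close>), and a polynomial is the finitely supported family of its coefficients.  The type
  \<open>('x, 'k) mpoly\<close> admits all elements of \<open>'x\<close> as variables; the polynomial ring in the variables
  \<open>V\<close> is the subring \<open>poly_ring V\<close>.
\<close>

type_synonym 'x monomial = "'x \<Rightarrow>\<^sub>0 nat"
type_synonym ('x, 'k) mpoly = "'x monomial \<Rightarrow>\<^sub>0 'k"

definition mdeg :: "'x monomial \<Rightarrow> nat"
  where "mdeg \<mu> = (\<Sum>x\<in>Poly_Mapping.keys \<mu>. Poly_Mapping.lookup \<mu> x)"

text \<open>The order \<open>\<le>\<close> on \<open>\<Rightarrow>\<^sub>0\<close> is lexicographic, hence a separate relation for divisibility.\<close>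

definition mdvd :: "'x monomial \<Rightarrow> 'x monomial \<Rightarrow> bool"
  where "mdvd \<nu> \<mu> \<longleftrightarrow> (\<forall>x. Poly_Mapping.lookup \<nu> x \<le> Poly_Mapping.lookup \<mu> x)"

definition var :: "'x \<Rightarrow> ('x, 'k::comm_ring_1) mpoly"
  where "var x = Poly_Mapping.single (Poly_Mapping.single x 1) 1"

definition const :: "'k::comm_ring_1 \<Rightarrow> ('x, 'k) mpoly"
  where "const c = Poly_Mapping.single 0 c"

definition homogeneous :: "nat \<Rightarrow> ('x monomial \<Rightarrow>\<^sub>0 'k::zero) \<Rightarrow> bool"
  where "homogeneous i p \<longleftrightarrow> (\<forall>\<mu>\<in>Poly_Mapping.keys p. mdeg \<mu> = i)"

definition monomials_in :: "'x set \<Rightarrow> 'x monomial set"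
  where "monomials_in V = {\<mu>. Poly_Mapping.keys \<mu> \<subseteq> V}"

definition poly_ring :: "'x set \<Rightarrow> ('x, 'k::comm_ring_1) mpoly ring"
  where "poly_ring V =
    \<lparr>carrier = {p. Poly_Mapping.keys p \<subseteq> monomials_in V},
     monoid.mult = (*), monoid.one = 1, ring.zero = 0, ring.add = (+)\<rparr>"

lemma monomials_in_zero: "0 \<in> monomials_in V"
  by (simp add: monomials_in_def)

lemma monomials_in_add:
  assumes "\<mu> \<in> monomials_in V" and "\<nu> \<in> monomials_in V"
  shows "\<mu> + \<nu> \<in> monomials_in V"
  using assms Poly_Mapping.keys_add[of \<mu> \<nu>] by (auto simp: monomials_in_def)

lemma cring_poly_ring: "cring (poly_ring V :: ('x, 'k::comm_ring_1) mpoly ring)"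
proof (rule cringI)
  show "abelian_group (poly_ring V :: ('x, 'k) mpoly ring)"
  proof (rule abelian_groupI)
    fix p :: "('x, 'k) mpoly"
    assume "p \<in> carrier (poly_ring V)"
    then show "\<exists>q\<in>carrier (poly_ring V). q \<oplus>\<^bsub>poly_ring V\<^esub> p = \<zero>\<^bsub>poly_ring V\<^esub>"
      by (intro bexI[of _ "- p"]) (auto simp: poly_ring_def)
  qed (use Poly_Mapping.keys_add in \<open>fastforce simp: poly_ring_def ac_simps\<close>)+
  show "Group.comm_monoid (poly_ring V :: ('x, 'k) mpoly ring)"
  proof (rule comm_monoidI)
    fix p q :: "('x, 'k) mpoly"
    assume "p \<in> carrier (poly_ring V)" and "q \<in> carrier (poly_ring V)"
    then show "p \<otimes>\<^bsub>poly_ring V\<^esub> q \<in> carrier (poly_ring V)"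
      using Poly_Mapping.keys_mult[of p q] monomials_in_add[of _ V] by (fastforce simp: poly_ring_def)
  qed (auto simp: poly_ring_def ac_simps monomials_in_zero)
qed (auto simp: poly_ring_def algebra_simps)


section \<open>The contraction action and annihilators\<close>

text \<open>
  An element of the dual space \<open>P\<close> is the finitely supported family of its coefficients with
  respect to the basis of symbols \<open>\<mu>\<^sup>*\<close>: \<open>Poly_Mapping.single \<mu> c\<close> stands for \<open>c \<mu>\<^sup>*\<close>.
  As \<open>deg \<mu>\<^sup>* = deg \<mu>\<close>, \<open>homogeneous\<close> is also the notion of homogeneity in \<open>P\<close>.
\<close>

type_synonym ('x, 'k) dual = "'x monomial \<Rightarrow>\<^sub>0 'k"

definition dual_space :: "'x set \<Rightarrow> ('x, 'k::comm_ring_1) dual set"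
  where "dual_space V = {f. Poly_Mapping.keys f \<subseteq> monomials_in V}"

definition dual_of :: "('x, 'k::comm_ring_1) mpoly \<Rightarrow> ('x, 'k) dual"
  where "dual_of p =
    (\<Sum>\<mu>\<in>Poly_Mapping.keys p. Poly_Mapping.single \<mu> (Poly_Mapping.lookup p \<mu>))"

definition contract :: "('x, 'k::comm_ring_1) mpoly \<Rightarrow> ('x, 'k) dual \<Rightarrow> ('x, 'k) dual"
  where "contract s f =
    (\<Sum>\<nu>\<in>Poly_Mapping.keys s. \<Sum>\<mu>\<in>Poly_Mapping.keys f.
       if mdvd \<nu> \<mu>
       then Poly_Mapping.single (\<mu> - \<nu>) (Poly_Mapping.lookup s \<nu> * Poly_Mapping.lookup f \<mu>)
       else 0)"

definition Ann :: "'x set \<Rightarrow> ('x, 'k::comm_ring_1) dual \<Rightarrow> ('x, 'k) mpoly set"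
  where "Ann V f = {s \<in> carrier (poly_ring V). contract s f = 0}"


section \<open>Hilbert functions and the small tangent space condition\<close>

text \<open>
  For a homogeneous ideal \<open>J\<close> of \<open>S = poly_ring V\<close>, \<open>hilbert V J i h\<close> states that
  \<open>H(S/J)\<^sub>i = h\<close>: the image of the degree \<open>i\<close> part of \<open>S\<close> in the quotient \<open>S/J\<close> has dimension
  \<open>h\<close> over the image of the field of constants.
\<close>

definition hilbert ::
    "'x set \<Rightarrow> ('x, 'k::field) mpoly set \<Rightarrow> nat \<Rightarrow> nat \<Rightarrow> bool"
  where "hilbert V J i h \<longleftrightarrow>
    ring.dimension (poly_ring V Quot J) h
      ((\<lambda>s. J +>\<^bsub>poly_ring V\<^esub> s) ` range const)
      ((\<lambda>s. J +>\<^bsub>poly_ring V\<^esub> s) ` {s \<in> carrier (poly_ring V). homogeneous i s})"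

definition has_hilbert_function ::
    "'x set \<Rightarrow> ('x, 'k::field) mpoly set \<Rightarrow> nat list \<Rightarrow> bool"
  where "has_hilbert_function V J hs \<longleftrightarrow>
    (\<forall>i. hilbert V J i (if i < length hs then hs ! i else 0))"

definition small_tangent_space :: "'x set \<Rightarrow> ('x, 'k::field) dual \<Rightarrow> bool"
  where "small_tangent_space V f \<longleftrightarrow>
    finite V \<and> f \<in> dual_space V \<and> homogeneous 3 f \<and>
    (let n = card V; I = Ann V f; I2 = I \<cdot>\<^bsub>poly_ring V\<^esub> I in
       has_hilbert_function V I [1, n, n, 1] \<and>
       hilbert V I2 4 n \<and>
       hilbert V I2 5 0)"


section \<open>The cubic\<close>

datatype vars = VA nat | VB nat | VC nat | VD

text \<open>The indices modulo \<open>m\<close> are represented by \<open>0, \<dots>, m - 1\<close>.\<close>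

definition cubic_vars :: "nat \<Rightarrow> vars set"
  where "cubic_vars m = VA ` {..<m} \<union> VB ` {..<m} \<union> VC ` {..<m} \<union> {VD}"

lemma card_cubic_vars: "card (cubic_vars m) = 3 * m + 1"
proof -
  have "card (VA ` {..<m} \<union> VB ` {..<m} \<union> VC ` {..<m}) = 3 * m"
    by (subst card_Un_disjoint | force simp: card_image inj_on_def)+
  moreover have "VD \<notin> VA ` {..<m} \<union> VB ` {..<m} \<union> VC ` {..<m}"
    by auto
  ultimately show ?thesis
    by (simp add: cubic_vars_def)
qed

definition cubic :: "nat \<Rightarrow> (vars, 'k::comm_ring_1) mpoly"
  where "cubic m =
    (\<Sum>i<m. let j = (i + 1) mod m in
       var (VA i) * var (VB i) * var (VC i)
       + var (VA i) * var (VA j) ^ 2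
       + var (VB i) * var (VB j) ^ 2
       + var (VC i) * var (VC j) ^ 2
       + var (VA i) * var (VB j) * var VD)"

end

theory Submission
  imports Defs
begin

text \<open>
  Contracting the cubic with a quadratic monomial \<open>x y\<close> gives either \<open>0\<close> or the dual of a single
  variable \<open>third x y\<close>.  Hence the quadratic part of the annihilator \<open>I\<close> is spanned by the null
  monomials \<open>x y\<close> and by the differences \<open>x y - z w\<close> of monomials with the same third variable.

  Multiplying such elements gives relations among the monomials of degree \<open>4\<close> modulo \<open>I\<^sup>2\<close>.
  A null pair \<open>x y\<close> turns every \<open>x y z w\<close> into one depending only on \<open>x\<close>, \<open>y\<close> and \<open>third z w\<close>,
  and this reduces all monomials with a null pair to the classes of \<open>x t\<close>, where \<open>t\<close> is a term of the
  cubic containing a variable \<open>y\<close> with \<open>x y\<close> null; following terms that avoid the neighbours of \<open>x\<close>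
  around the cycle shows that this class depends on \<open>x\<close> alone.  The monomials without null pair are
  supported on a few consecutive indices, and are expressed by the others through products of two
  differences.  So degree \<open>4\<close> of \<open>S/I\<^sup>2\<close> has dimension at most \<open>n\<close>, and the \<open>n\<close> functionals
  \<open>s \<mapsto> (\<partial>s/\<partial>x) F\<close>, which kill \<open>I\<^sup>2\<close>, show equality in every characteristic.  In degree \<open>5\<close>
  the same relations hold after multiplication with a variable \<open>v\<close>, and there \<open>v x t\<close> lies in \<open>I\<^sup>2\<close>:
  choose \<open>y\<close> in \<open>t\<close> with both \<open>v y\<close> and \<open>x y\<close> null; then \<open>x t / y\<close> is not a term of the cubic.
\<close>

section \<open>Polynomials, contraction and Hilbert functions\<close>

definition pairing :: "('a \<Rightarrow>\<^sub>0 'k::comm_ring_1) \<Rightarrow> ('a \<Rightarrow> 'k) \<Rightarrow> 'k"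
  where "pairing p \<phi> = (\<Sum>\<nu>\<in>Poly_Mapping.keys p. Poly_Mapping.lookup p \<nu> * \<phi> \<nu>)"

lemma pairing_superset:
  assumes "finite A" "Poly_Mapping.keys p \<subseteq> A"
  shows "pairing p \<phi> = (\<Sum>\<nu>\<in>A. Poly_Mapping.lookup p \<nu> * \<phi> \<nu>)"
  unfolding pairing_def using assms by (intro sum.mono_neutral_left) (auto simp: in_keys_iff)

lemma pairing_zero [simp]: "pairing 0 \<phi> = 0"
  by (simp add: pairing_def)

lemma pairing_single [simp]: "pairing (Poly_Mapping.single \<mu> c) \<phi> = c * \<phi> \<mu>"
  by (simp add: pairing_def)

lemma pairing_add: "pairing (p + q) \<phi> = pairing p \<phi> + pairing q \<phi>"
proof -
  let ?A = "Poly_Mapping.keys p \<union> Poly_Mapping.keys q"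
  have "pairing (p + q) \<phi> = (\<Sum>\<nu>\<in>?A. Poly_Mapping.lookup (p + q) \<nu> * \<phi> \<nu>)"
    using Poly_Mapping.keys_add[of p q] by (intro pairing_superset) auto
  then show ?thesis
    by (simp add: pairing_superset[of ?A] lookup_add sum.distrib algebra_simps)
qed

lemma pairing_uminus: "pairing (- p) \<phi> = - pairing p \<phi>"
  using pairing_add[of p "- p" \<phi>] by (simp add: eq_neg_iff_add_eq_0 add.commute)

lemma pairing_diff: "pairing (p - q) \<phi> = pairing p \<phi> - pairing q \<phi>"
  using pairing_add[of p "- q" \<phi>] by (simp add: pairing_uminus)

lemma pairing_sum: "pairing (sum f A) \<phi> = (\<Sum>x\<in>A. pairing (f x) \<phi>)"
  by (induction A rule: infinite_finite_induct) (auto simp: pairing_add)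

lemma pairing_fun_zero [simp]: "pairing p (\<lambda>\<nu>. 0) = 0"
  by (simp add: pairing_def)

lemma pairing_fun_add: "pairing p (\<lambda>\<nu>. \<phi> \<nu> + \<psi> \<nu>) = pairing p \<phi> + pairing p \<psi>"
  by (simp add: pairing_def sum.distrib algebra_simps)

lemma pairing_fun_scale: "pairing p (\<lambda>\<nu>. c * \<phi> \<nu>) = c * pairing p \<phi>"
  by (simp add: pairing_def sum_distrib_left algebra_simps)

lemma pairing_swap:
  "pairing p (\<lambda>\<alpha>. pairing q (\<lambda>\<beta>. \<phi> \<alpha> \<beta>)) = pairing q (\<lambda>\<beta>. pairing p (\<lambda>\<alpha>. \<phi> \<alpha> \<beta>))"
  unfolding pairing_def sum_distrib_left by (subst sum.swap) (simp add: algebra_simps)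

lemma poly_mapping_single_induct [case_names single add]:
  assumes "\<And>k v. P (Poly_Mapping.single k v)" "\<And>f g. P f \<Longrightarrow> P g \<Longrightarrow> P (f + g)"
  shows "P (f :: 'a \<Rightarrow>\<^sub>0 'b::monoid_add)"
proof (induction f rule: update_induct)
  case const
  show ?case
    using assms(1)[of _ 0] by simp
next
  case (update f a b)
  then have "Poly_Mapping.update a b f = f + Poly_Mapping.single a b"
    by (intro poly_mapping_eqI) (auto simp: lookup_update lookup_add lookup_single in_keys_iff)
  then show ?case
    using assms update by simp
qed

text \<open>Both sides are additive in p and in q, so it is enough to compare one-term
  polynomials.\<close>

lemma pairing_mult:
  "pairing (p * q) \<phi> = pairing p (\<lambda>\<alpha>. pairing q (\<lambda>\<beta>. \<phi> (\<alpha> + \<beta>)))"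
proof (induction p rule: poly_mapping_single_induct)
  case (single \<alpha> c)
  show ?case
  proof (induction q rule: poly_mapping_single_induct)
    case (add f g)
    then show ?case
      by (simp add: distrib_left pairing_add)
  qed (simp add: mult_single algebra_simps)
next
  case (add f g)
  then show ?case
    by (simp add: distrib_right pairing_add)
qed

lemma const_mult_add: "const (a + b) * p = const a * p + const b * p"
  by (simp add: const_def single_add distrib_right)

lemma pairing_const_mult: "pairing (const c * p) \<phi> = c * pairing p \<phi>"
  by (simp add: pairing_mult const_def)

text \<open>A term of f with exponent \<kappa> contributes to the coefficient at \<mu> exactly when
  \<kappa> = \<mu> + \<nu>. Each coefficient of the contraction is therefore a linear functional of
  p, and an annihilator is the solution set of linear equations.\<close>

lemma lookup_contract:
  "Poly_Mapping.lookup (contract p f) \<mu> = pairing p (\<lambda>\<nu>. Poly_Mapping.lookup f (\<mu> + \<nu>))"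
proof -
  let ?g = "\<lambda>\<nu> \<kappa>. if mdvd \<nu> \<kappa> then Poly_Mapping.single (\<kappa> - \<nu>) (Poly_Mapping.lookup p \<nu> * Poly_Mapping.lookup f \<kappa>) else 0"
  have "Poly_Mapping.lookup (?g \<nu> \<kappa>) \<mu> =
      (if \<kappa> = \<mu> + \<nu> then Poly_Mapping.lookup p \<nu> * Poly_Mapping.lookup f (\<mu> + \<nu>) else 0)" for \<nu> \<kappa>
  proof (cases "mdvd \<nu> \<kappa>")
    case True
    then have "\<kappa> = (\<kappa> - \<nu>) + \<nu>"
      by (intro poly_mapping_eqI) (simp add: mdvd_def lookup_add lookup_minus)
    then have "\<kappa> - \<nu> = \<mu> \<longleftrightarrow> \<kappa> = \<mu> + \<nu>"
      by (metis add_right_cancel)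
    with True show ?thesis
      by (auto simp: lookup_single when_def)
  next
    case False
    then have "\<kappa> \<noteq> \<mu> + \<nu>"
      by (auto simp: mdvd_def lookup_add)
    with False show ?thesis
      by simp
  qed
  then show ?thesis
    unfolding contract_def pairing_def lookup_sum
    by (intro sum.cong refl) (auto simp: in_keys_iff)
qed

lemma contract_eq_0_iff: "contract p f = 0 \<longleftrightarrow> (\<forall>\<mu>. pairing p (\<lambda>\<nu>. Poly_Mapping.lookup f (\<mu> + \<nu>)) = 0)"
  by (simp add: poly_mapping_eq_iff fun_eq_iff lookup_contract)

text \<open>A polynomial and its dual element have the same family of coefficients, so all later
  work is done with \<open>cubic m\<close> itself.\<close>

lemma dual_of_eq: "dual_of p = p"
proof (rule poly_mapping_eqI)
  fix \<mu>
  show "Poly_Mapping.lookup (dual_of p) \<mu> = Poly_Mapping.lookup p \<mu>"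
    by (auto simp: dual_of_def lookup_sum lookup_single when_def in_keys_iff)
qed

section \<open>Membership, ideals and cosets in the polynomial ring\<close>

lemma carrier_poly_ring: "carrier (poly_ring V) = {p. Poly_Mapping.keys p \<subseteq> monomials_in V}"
  and add_poly_ring [simp]: "p \<oplus>\<^bsub>poly_ring V\<^esub> q = p + q"
  and mult_poly_ring [simp]: "p \<otimes>\<^bsub>poly_ring V\<^esub> q = p * q"
  and zero_poly_ring [simp]: "\<zero>\<^bsub>poly_ring V\<^esub> = 0"
  and one_poly_ring [simp]: "\<one>\<^bsub>poly_ring V\<^esub> = 1"
  by (simp_all add: poly_ring_def)

lemma ring_poly_ring: "ring (poly_ring V :: ('x, 'k::comm_ring_1) mpoly ring)"
  using cring_poly_ring by (rule cring.axioms)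

lemma uminus_poly_ring:
  assumes "p \<in> carrier (poly_ring V :: ('x, 'k::comm_ring_1) mpoly ring)"
  shows "\<ominus>\<^bsub>poly_ring V\<^esub> p = - p"
proof -
  interpret ring "poly_ring V :: ('x, 'k) mpoly ring" by (rule ring_poly_ring)
  show ?thesis
    by (rule minus_equality) (use assms in \<open>auto simp: carrier_poly_ring\<close>)
qed

lemma carrier_add: "p \<in> carrier (poly_ring V) \<Longrightarrow> q \<in> carrier (poly_ring V) \<Longrightarrow> p + q \<in> carrier (poly_ring V)"
  using ring.ring_simprules(1)[OF ring_poly_ring, of p V q] by simp

lemma carrier_mult: "p \<in> carrier (poly_ring V) \<Longrightarrow> q \<in> carrier (poly_ring V) \<Longrightarrow> p * q \<in> carrier (poly_ring V)"
  using ring.ring_simprules(5)[OF ring_poly_ring, of p V q] by simp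

lemma carrier_uminus: "p \<in> carrier (poly_ring V) \<Longrightarrow> - p \<in> carrier (poly_ring V)"
  by (simp add: carrier_poly_ring)

lemma carrier_diff: "p \<in> carrier (poly_ring V) \<Longrightarrow> q \<in> carrier (poly_ring V) \<Longrightarrow> p - q \<in> carrier (poly_ring V)"
  using carrier_add[of p V "- q"] by (simp add: carrier_uminus)

lemma carrier_const: "const c \<in> carrier (poly_ring V)"
  by (auto simp: carrier_poly_ring const_def monomials_in_zero)

lemma carrier_zero: "0 \<in> carrier (poly_ring V)"
  by (simp add: carrier_poly_ring)

lemma carrier_sum: "(\<And>x. x \<in> B \<Longrightarrow> f x \<in> carrier (poly_ring V)) \<Longrightarrow> (\<Sum>x\<in>B. f x) \<in> carrier (poly_ring V)"
  by (induction B rule: infinite_finite_induct) (auto simp: carrier_add carrier_zero)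

lemma carrier_single: "\<mu> \<in> monomials_in V \<Longrightarrow> Poly_Mapping.single \<mu> c \<in> carrier (poly_ring V)"
  by (auto simp: carrier_poly_ring)

context
  fixes V :: "'x set" and J :: "('x, 'k::comm_ring_1) mpoly set"
  assumes J: "ideal J (poly_ring V)"
begin

lemma ideal_zero: "0 \<in> J"
  using additive_subgroup.zero_closed[OF ideal.axioms(1)[OF J]] by simp

lemma ideal_add: "p \<in> J \<Longrightarrow> q \<in> J \<Longrightarrow> p + q \<in> J"
  using additive_subgroup.a_closed[OF ideal.axioms(1)[OF J]] by force

lemma ideal_mult: "p \<in> J \<Longrightarrow> q \<in> carrier (poly_ring V) \<Longrightarrow> q * p \<in> J"
  using ideal.I_l_closed[OF J] by force

lemma ideal_uminus: "p \<in> J \<Longrightarrow> - p \<in> J"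
  using ideal_mult[of p "- 1"] carrier_const[of "- 1" V] by (simp add: const_def single_uminus)

lemma ideal_diff: "p \<in> J \<Longrightarrow> q \<in> J \<Longrightarrow> p - q \<in> J"
  using ideal_add[of p "- q"] ideal_uminus by simp

lemma ideal_sum: "(\<And>x. x \<in> B \<Longrightarrow> f x \<in> J) \<Longrightarrow> (\<Sum>x\<in>B. f x) \<in> J"
  by (induction B rule: infinite_finite_induct) (auto simp: ideal_zero ideal_add)

lemma coset_eq_iff:
  assumes "p \<in> carrier (poly_ring V)" "q \<in> carrier (poly_ring V)"
  shows "J +>\<^bsub>poly_ring V\<^esub> p = J +>\<^bsub>poly_ring V\<^esub> q \<longleftrightarrow> p - q \<in> J"
  using ring.quotient_eq_iff_same_a_r_cos[OF ring_poly_ring J assms] assms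
  by (simp add: a_minus_def uminus_poly_ring)

end

text \<open>Multiplication by q only shifts the index \<mu> by the monomials of q, so products
  inherit the equations that define the annihilator.\<close>

lemma ideal_Ann:
  fixes V :: "'x set" and f :: "('x, 'k::comm_ring_1) dual"
  shows "ideal (Ann V f) (poly_ring V)"
proof (rule idealI)
  have *: "p \<in> Ann V f \<longleftrightarrow> p \<in> carrier (poly_ring V) \<and> (\<forall>\<mu>. pairing p (\<lambda>\<nu>. Poly_Mapping.lookup f (\<mu> + \<nu>)) = 0)" for p
    by (simp add: Ann_def contract_eq_0_iff)
  show "ring (poly_ring V :: ('x, 'k) mpoly ring)"
    by (rule ring_poly_ring)
  then interpret ring "poly_ring V :: ('x, 'k) mpoly ring" .
  show "subgroup (Ann V f) (add_monoid (poly_ring V))"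
  proof (rule add.subgroupI)
    show "Ann V f \<noteq> {}"
      using *[of 0] by (auto simp: carrier_zero)
  qed (auto simp: * carrier_add carrier_uminus pairing_add pairing_uminus uminus_poly_ring simp flip: a_inv_def)
  fix p q :: "('x, 'k) mpoly"
  assume "p \<in> Ann V f" "q \<in> carrier (poly_ring V)"
  then show "q \<otimes>\<^bsub>poly_ring V\<^esub> p \<in> Ann V f"
    by (auto simp: * carrier_mult pairing_mult simp flip: add.assoc)
  then show "p \<otimes>\<^bsub>poly_ring V\<^esub> q \<in> Ann V f"
    by (simp add: mult.commute)
qed

section \<open>A dual-basis criterion for Hilbert functions\<close>

lemma homogeneous_add: "homogeneous i p \<Longrightarrow> homogeneous i q \<Longrightarrow> homogeneous i (p + q)"
  using Poly_Mapping.keys_add[of p q] by (auto simp: homogeneous_def)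

lemma homogeneous_const_mult: "homogeneous i p \<Longrightarrow> homogeneous i (const c * p)"
  using Poly_Mapping.keys_mult[of "const c" p]
  by (fastforce simp: homogeneous_def const_def split: if_splits)

lemma homogeneous_lincomb:
  "(\<And>x. x \<in> B \<Longrightarrow> homogeneous i (u x)) \<Longrightarrow> homogeneous i (\<Sum>x\<in>B. const (c x) * u x)"
  by (induction B rule: infinite_finite_induct)
    (auto simp: homogeneous_add homogeneous_const_mult, auto simp: homogeneous_def)

lemma carrier_lincomb:
  "(\<And>x. x \<in> B \<Longrightarrow> u x \<in> carrier (poly_ring V)) \<Longrightarrow> (\<Sum>x\<in>B. const (c x) * u x) \<in> carrier (poly_ring V)"
  by (intro carrier_sum carrier_mult carrier_const)

lemma lincomb_single: "(\<Sum>\<mu>\<in>Poly_Mapping.keys p. const (Poly_Mapping.lookup p \<mu>) * Poly_Mapping.single \<mu> 1) = p"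
  using dual_of_eq[of p] by (simp add: dual_of_def const_def mult_single)

lemma const_sum: "const (sum f A) = (\<Sum>x\<in>A. const (f x))"
  by (induction A rule: infinite_finite_induct) (auto simp: const_def single_add)

lemma const_mult: "const (a * b) = const a * const b"
  by (simp add: const_def mult_single)

text \<open>The family u spans the degree i part modulo J. The functionals \<phi> descend to the
  quotient because they kill J, and being dual to u they force linear independence.\<close>

theorem hilbertI:
  fixes u :: "'i \<Rightarrow> ('x, 'k::field) mpoly" and \<phi> :: "'i \<Rightarrow> 'x monomial \<Rightarrow> 'k"
  assumes J: "ideal J (poly_ring V)" and fin: "finite B"
    and u: "\<And>x. x \<in> B \<Longrightarrow> u x \<in> carrier (poly_ring V)" "\<And>x. x \<in> B \<Longrightarrow> homogeneous i (u x)"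
    and generate: "\<And>\<mu>. \<mu> \<in> monomials_in V \<Longrightarrow> mdeg \<mu> = i \<Longrightarrow>
      \<exists>c. Poly_Mapping.single \<mu> 1 - (\<Sum>x\<in>B. const (c x) * u x) \<in> J"
    and dual: "\<And>x p. x \<in> B \<Longrightarrow> p \<in> J \<Longrightarrow> pairing p (\<phi> x) = 0"
      "\<And>x y. x \<in> B \<Longrightarrow> y \<in> B \<Longrightarrow> pairing (u y) (\<phi> x) = (if x = y then 1 else 0)"
  shows "hilbert V J i (card B)"
proof -
  let ?R = "poly_ring V :: ('x, 'k) mpoly ring"
  let ?h = "\<lambda>p. J +>\<^bsub>?R\<^esub> p"
  let ?lc = "\<lambda>c Y. \<Sum>x\<in>Y. const (c x) * u x"
  \<comment> \<open>The image in the quotient of the span of the u x with x in Y.\<close>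
  define E where "E Y = {?h (?lc c Y) | c. True}" for Y
  interpret ideal J ?R by (rule J)
  interpret h: ring_hom_ring ?R "?R Quot J" ?h by (rule rcos_ring_hom_ring)
  have lc: "?lc c Y \<in> carrier ?R" if "Y \<subseteq> B" for c Y
    using that u(1) by (intro carrier_lincomb) auto
  have dim: "ring.dimension (?R Quot J) (card Y) (?h ` range const) (E Y)" if "Y \<subseteq> B" for Y
    using finite_subset[OF that fin] that
  proof (induction Y rule: finite_induct)
    case empty
    have "E {} = {\<zero>\<^bsub>?R Quot J\<^esub>}"
      using h.hom_zero by (simp add: E_def)
    then show ?case
      by (simp add: h.S.dimension.zero_dim)
  next
    case (insert y Y)
    then have y: "y \<in> B" "Y \<subseteq> B" and uy: "u y \<in> carrier ?R"
      using u by auto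
    \<comment> \<open>The functional \<phi> y is 1 on u y but 0 on every combination of the u x with
      x in Y.\<close>
    have "?h (u y) \<notin> E Y"
    proof
      assume "?h (u y) \<in> E Y"
      then obtain c where "?h (u y) = ?h (?lc c Y)"
        by (auto simp: E_def)
      then have "u y - ?lc c Y \<in> J"
        using coset_eq_iff[OF J uy lc[OF y(2)]] by simp
      then have "0 = pairing (u y - ?lc c Y) (\<phi> y)"
        using dual(1)[OF y(1)] by simp
      also have "\<dots> = 1 - (\<Sum>x\<in>Y. c x * (if y = x then 1 else 0))"
        using y by (auto simp: pairing_diff pairing_sum pairing_const_mult dual(2) intro!: sum.cong)
      also have "(\<Sum>x\<in>Y. c x * (if y = x then 1 else 0)) = 0"
        using insert.hyps by (intro sum.neutral) auto
      finally show False by simp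
    qed
    \<comment> \<open>The inductive \<open>dimension\<close> adjoins one vector at a time, so the
      span over \<open>insert y Y\<close> has to be recognised as a line extension of the span over
      Y.\<close>
    moreover have "h.S.line_extension (?h ` range const) (?h (u y)) (E Y) = E (insert y Y)"
    proof -
      have sum_eq: "?h (const k) \<otimes>\<^bsub>?R Quot J\<^esub> ?h (u y) \<oplus>\<^bsub>?R Quot J\<^esub> ?h (?lc c Y) = ?h (const k * u y + ?lc c Y)" for k c
        using h.hom_mult[of "const k" "u y"] h.hom_add[of "const k * u y" "?lc c Y"] uy lc[OF y(2), of c]
        by (simp add: carrier_const carrier_mult)
      show ?thesis
      proof (intro equalityI subsetI)
        fix z
        assume "z \<in> h.S.line_extension (?h ` range const) (?h (u y)) (E Y)"
        then obtain k c where "z = ?h (const k * u y + ?lc c Y)"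
          unfolding h.S.line_extension_mem_iff by (auto simp: E_def sum_eq)
        moreover have "const k * u y + ?lc c Y = ?lc (c(y := k)) (insert y Y)"
          using insert.hyps by (auto intro!: sum.cong)
        ultimately have "z = ?h (?lc (c(y := k)) (insert y Y))"
          by (simp only:)
        then show "z \<in> E (insert y Y)"
          unfolding E_def by blast
      next
        fix z
        assume "z \<in> E (insert y Y)"
        then obtain c where "z = ?h (?lc c (insert y Y))"
          unfolding E_def by blast
        then have "z = ?h (const (c y)) \<otimes>\<^bsub>?R Quot J\<^esub> ?h (u y) \<oplus>\<^bsub>?R Quot J\<^esub> ?h (?lc c Y)"
          using insert.hyps by (simp add: sum_eq)
        then show "z \<in> h.S.line_extension (?h ` range const) (?h (u y)) (E Y)"
          unfolding h.S.line_extension_mem_iff E_def by blast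
      qed
    qed
    ultimately show ?case
      using h.S.dimension.Suc_dim[of "?h (u y)" "E Y" "card Y" "?h ` range const"] insert.IH[OF y(2)]
        insert.hyps h.hom_closed[OF uy] by simp
  qed
  have "E B = ?h ` {p \<in> carrier ?R. homogeneous i p}"
  proof (intro equalityI subsetI)
    fix z
    assume "z \<in> E B"
    then show "z \<in> ?h ` {p \<in> carrier ?R. homogeneous i p}"
      using u lc by (auto simp: E_def intro!: imageI homogeneous_lincomb)
  next
    fix z
    assume "z \<in> ?h ` {p \<in> carrier ?R. homogeneous i p}"
    then obtain p where p: "z = ?h p" "p \<in> carrier ?R" "homogeneous i p"
      by auto
    have "\<exists>c. Poly_Mapping.single \<mu> 1 - ?lc c B \<in> J" if "\<mu> \<in> Poly_Mapping.keys p" for \<mu>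
      using generate[of \<mu>] p(2,3) that by (auto simp: carrier_poly_ring homogeneous_def)
    then obtain c where c: "\<And>\<mu>. \<mu> \<in> Poly_Mapping.keys p \<Longrightarrow> Poly_Mapping.single \<mu> 1 - ?lc (c \<mu>) B \<in> J"
      by metis
    \<comment> \<open>Coefficients of p with respect to u, obtained by expanding every monomial of p
      separately.\<close>
    let ?a = "\<lambda>x. \<Sum>\<mu>\<in>Poly_Mapping.keys p. Poly_Mapping.lookup p \<mu> * c \<mu> x"
    have "(\<Sum>\<mu>\<in>Poly_Mapping.keys p. const (Poly_Mapping.lookup p \<mu>) * (Poly_Mapping.single \<mu> 1 - ?lc (c \<mu>) B)) \<in> J"
      using c by (intro ideal_sum[OF J] ideal_mult[OF J] carrier_const)
    also have "(\<Sum>\<mu>\<in>Poly_Mapping.keys p. const (Poly_Mapping.lookup p \<mu>) * (Poly_Mapping.single \<mu> 1 - ?lc (c \<mu>) B))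
        = p - ?lc ?a B"
    proof -
      have "?lc ?a B = (\<Sum>\<mu>\<in>Poly_Mapping.keys p. const (Poly_Mapping.lookup p \<mu>) * ?lc (c \<mu>) B)"
        unfolding const_sum const_mult sum_distrib_left sum_distrib_right by (subst sum.swap) (simp add: mult.assoc)
      then show ?thesis
        by (simp add: right_diff_distrib sum_subtractf lincomb_single)
    qed
    finally show "z \<in> E B"
      using coset_eq_iff[OF J p(2) lc[of B]] p(1) by (auto simp: E_def)
  qed
  with dim[OF subset_refl] show ?thesis
    by (simp add: hilbert_def)
qed

section \<open>Products of four variables\<close>

locale cyclic_index =
  fixes m :: nat
  assumes m6: "6 \<le> m"
begin

text \<open>
  \<open>nxt\<close> and \<open>prv\<close> rotate each block \<open>{q m..<q m + m}\<close> of naturals, so that they are mutually inverse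
  on all of \<open>nat\<close> and no side conditions \<open>i < m\<close> arise.
\<close>

definition nxt :: "nat \<Rightarrow> nat"
  where "nxt i = (if m dvd Suc i then Suc i - m else Suc i)"

definition prv :: "nat \<Rightarrow> nat"
  where "prv i = (if m dvd i then i + m - 1 else i - 1)"

lemma nxt_prv [simp]: "nxt (prv i) = i"
proof (cases "m dvd i")
  case False
  then have "Suc (i - 1) = i"
    by (cases i) auto
  with False show ?thesis
    by (simp add: nxt_def prv_def)
qed (use m6 in \<open>simp add: nxt_def prv_def\<close>)

lemma prv_nxt [simp]: "prv (nxt i) = i"
proof (cases "m dvd Suc i")
  case True
  then have "m \<le> Suc i" "m dvd Suc i - m"
    by (auto dest: dvd_imp_le)
  with True m6 show ?thesis
    by (simp add: nxt_def prv_def)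
qed (simp add: nxt_def prv_def)

text \<open>Oriented so that simp moves \<open>nxt\<close> to the other side of an index equation as
  \<open>prv\<close>; what remains compares iterates of \<open>prv\<close>, which
  \<open>prv_neq\<close> can refute.\<close>

lemma nxt_eq_iff [simp]: "nxt i = j \<longleftrightarrow> i = prv j" "j = nxt i \<longleftrightarrow> i = prv j"
  by auto

lemma prv_eq_prv_iff [simp]: "prv i = prv j \<longleftrightarrow> i = j"
  by (metis nxt_prv)

lemma prv_add_1: "prv i + 1 = i \<or> prv i + 1 = i + m"
  using m6 by (cases i) (auto simp: prv_def)

text \<open>Each application of \<open>prv\<close> changes the index by -1 or by m - 1. After k
  applications the change is -k plus a multiple of m, which is nonzero for 0 < k < m.\<close>

lemma prv_neq [simp]: "prv i \<noteq> i" "prv (prv i) \<noteq> i" "prv (prv (prv i)) \<noteq> i" "prv (prv (prv (prv i))) \<noteq> i"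
  "prv (prv (prv (prv (prv i)))) \<noteq> i"
  using m6 prv_add_1[of i] prv_add_1[of "prv i"] prv_add_1[of "prv (prv i)"] prv_add_1[of "prv (prv (prv i))"]
    prv_add_1[of "prv (prv (prv (prv i)))"] by linarith+

lemmas prv_neq' [simp] = prv_neq[symmetric]

lemma prv_less [simp]: "prv i < m \<longleftrightarrow> i < m"
proof (cases "m dvd i")
  case True
  then have "i = 0 \<or> m \<le> i"
    by (auto dest: dvd_imp_le)
  with True m6 show ?thesis
    by (auto simp: prv_def)
next
  case False
  then have "i \<noteq> m" "i \<noteq> 0"
    by (metis dvd_refl, metis dvd_0_right)
  with False m6 show ?thesis
    by (auto simp: prv_def)
qed

lemma nxt_less [simp]: "nxt i < m \<longleftrightarrow> i < m"
  by (metis prv_less prv_nxt)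

lemma nxt_eq_mod: "i < m \<Longrightarrow> nxt i = (i + 1) mod m"
  using m6 by (cases "Suc i = m") (auto simp: nxt_def dest: dvd_imp_le)

section \<open>Terms of the cubic through a pair of variables\<close>

definition cyc3 :: "(nat \<Rightarrow> vars) \<Rightarrow> nat \<Rightarrow> nat \<Rightarrow> vars option"
  where "cyc3 C i j = (if i = j then Some (C (prv i)) else if j = nxt i then Some (C j)
     else if i = nxt j then Some (C i) else None)"

text \<open>Each pair of variables, equal or not, divides at most one term of the cubic, so the
  remaining factor is an option and \<open>None\<close> marks a null pair. \<open>cyc3\<close>
  treats the terms C_i C_{i+1}^2 of one family. The range of the indices is left open here and
  restored in \<open>coeff_mset3\<close>.\<close>

fun third :: "vars \<Rightarrow> vars \<Rightarrow> vars option"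
  where
    "third (VA i) (VA j) = cyc3 VA i j"
  | "third (VB i) (VB j) = cyc3 VB i j"
  | "third (VC i) (VC j) = cyc3 VC i j"
  | "third (VA i) (VB j) = (if i = j then Some (VC i) else if i = prv j then Some VD else None)"
  | "third (VB j) (VA i) = (if i = j then Some (VC i) else if i = prv j then Some VD else None)"
  | "third (VA i) (VC j) = (if i = j then Some (VB i) else None)"
  | "third (VC j) (VA i) = (if i = j then Some (VB i) else None)"
  | "third (VB i) (VC j) = (if i = j then Some (VA i) else None)"
  | "third (VC j) (VB i) = (if i = j then Some (VA i) else None)"
  | "third (VA i) VD = Some (VB (nxt i))"
  | "third VD (VA i) = Some (VB (nxt i))"
  | "third (VB i) VD = Some (VA (prv i))"
  | "third VD (VB i) = Some (VA (prv i))"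
  | "third (VC i) VD = None"
  | "third VD (VC i) = None"
  | "third VD VD = None"

lemma third_commute: "third x y = third y x"
  by (cases x; cases y) (auto simp: cyc3_def)

lemma third_rotate: "third x y = Some z \<Longrightarrow> third x z = Some y"
  by (cases x; cases y; cases z) (auto simp: cyc3_def split: if_splits)

lemma mem_vars [simp]:
  "VA i \<in> cubic_vars m \<longleftrightarrow> i < m" "VB i \<in> cubic_vars m \<longleftrightarrow> i < m"
  "VC i \<in> cubic_vars m \<longleftrightarrow> i < m" "VD \<in> cubic_vars m"
  by (auto simp: cubic_vars_def)

lemma third_in_V: "third x y = Some z \<Longrightarrow> x \<in> cubic_vars m \<Longrightarrow> y \<in> cubic_vars m \<Longrightarrow> z \<in> cubic_vars m"
  by (cases x; cases y) (auto simp: cyc3_def split: if_splits)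

text \<open>Deleting i from the cycle leaves a path that starts at \<open>nxt i\<close>, and
  \<open>step\<close> carries R along it.\<close>

lemma cyclic_induct:
  assumes step: "\<And>j. j < m \<Longrightarrow> j \<noteq> i \<Longrightarrow> nxt j \<noteq> i \<Longrightarrow> R j \<longleftrightarrow> R (nxt j)"
    and "i < m" "j < m" "j \<noteq> i"
  shows "R j \<longleftrightarrow> R (nxt i)"
proof -
  \<comment> \<open>Here k is the distance from \<open>nxt i\<close>; the bound on k stops the walk
    before it returns to i.\<close>
  have "R ((i + Suc k) mod m) \<longleftrightarrow> R (nxt i)" if "Suc k < m" for k
    using that
  proof (induction k)
    case 0
    then show ?case
      using \<open>i < m\<close> by (simp add: nxt_eq_mod)
  next
    case (Suc k)
    let ?j = "(i + Suc k) mod m"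
    have "nxt ?j = (i + Suc (Suc k)) mod m"
      using m6 by (subst nxt_eq_mod) (auto simp: mod_Suc_eq)
    moreover have "(i + Suc l) mod m \<noteq> i" if "Suc l < m" for l
      using that \<open>i < m\<close> by (cases "i + Suc l < m") (auto simp: mod_if)
    ultimately show ?case
      using Suc step[of ?j] m6 by (metis Suc_lessD mod_less_divisor not_numeral_le_zero neq0_conv)
  qed
  moreover obtain k where "Suc k < m" "j = (i + Suc k) mod m"
  proof (cases "i < j")
    case True
    then show thesis
      using that[of "j - i - 1"] \<open>j < m\<close> by simp
  next
    case False
    then have "Suc (j + m - i - 1) < m" "i + Suc (j + m - i - 1) = m + j"
      using \<open>i < m\<close> \<open>j \<noteq> i\<close> by auto
    then show thesis
      using that[of "j + m - i - 1"] \<open>j < m\<close> by simp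
  qed
  ultimately show ?thesis
    by blast
qed

text \<open>Five values cannot exhaust six or more indices.\<close>

lemma avoid5: obtains i where "i < m" "i \<notin> {a, b, c, d, e}"
proof -
  have "card {a, b, c, d, e} < card {..<m}"
    using m6 by (simp add: card_insert_if)
  then have "\<not> {..<m} \<subseteq> {a, b, c, d, e}"
    using card_mono[of "{a, b, c, d, e}" "{..<m}"] by auto
  then show thesis
    using that by auto
qed

end

text \<open>
  Two instances of \<open>P\<close> matter: membership of a quartic monomial in the span of \<open>I\<^sup>2\<close> and \<open>n\<close> chosen
  monomials, and membership in \<open>I\<^sup>2\<close> of its product with a fixed variable.  In both \<open>swap_swap\<close> comes
  from the four-term product \<open>(x y - x' y') (z w - z' w')\<close>.
\<close>

locale quartic_rules = cyclic_index +
  fixes P :: "vars multiset \<Rightarrow> bool"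
  assumes null_null: "\<And>x y z w. \<lbrakk>third x y = None; third z w = None; {x, y, z, w} \<subseteq> cubic_vars m\<rbrakk>
      \<Longrightarrow> P {#x, y, z, w#}"
    and null_swap: "\<And>x y z w z' w'. \<lbrakk>third x y = None; third z w \<noteq> None; third z w = third z' w';
      {x, y, z, w, z', w'} \<subseteq> cubic_vars m; P {#x, y, z', w'#}\<rbrakk> \<Longrightarrow> P {#x, y, z, w#}"
    and swap_swap: "\<And>x y x' y' z w z' w'. \<lbrakk>third x y \<noteq> None; third x y = third x' y'; third z w \<noteq> None;
      third z w = third z' w'; {x, y, x', y', z, w, z', w'} \<subseteq> cubic_vars m;
      P {#x, y, z', w'#}; P {#x', y', z, w#}; P {#x', y', z', w'#}\<rbrakk> \<Longrightarrow> P {#x, y, z, w#}"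
    and start: "\<And>x. x \<in> cubic_vars m \<Longrightarrow> \<exists>y z w. third x y = None \<and> y \<noteq> x \<and> third z w = Some y \<and>
      {y, z, w} \<subseteq> cubic_vars m \<and> P {#x, y, z, w#}"
begin

section \<open>Products with a null pair\<close>

abbreviation V :: "vars set" where "V \<equiv> cubic_vars m"

text \<open>The class of x y times a quadric with third variable v, freed from the choice of z w.
  When x y is null, \<open>null_swap\<close> makes one representative sufficient
  (\<open>QI\<close>).\<close>

definition Q :: "vars \<Rightarrow> vars \<Rightarrow> vars \<Rightarrow> bool"
  where "Q x y v \<longleftrightarrow> (\<forall>z\<in>V. \<forall>w\<in>V. third z w = Some v \<longrightarrow> P {#x, y, z, w#})"

lemma QI:
  assumes "P {#x, y, z, w#}" "third z w = Some v" "third x y = None" "{x, y, z, w} \<subseteq> V"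
  shows "Q x y v"
  using assms null_swap[of x y _ _ z w] by (auto simp: Q_def)

lemma Q_commute: "Q x y v \<Longrightarrow> Q y x v"
  by (simp add: Q_def add_mset_commute)

text \<open>Regrouped as (x u)(y u'), the representative is a product of two null pairs.\<close>

lemma Q_free:
  assumes "third x u = None" "third y u' = None" "third u u' = Some v" "third x y = None"
    "{x, y, u, u'} \<subseteq> V"
  shows "Q x y v"
  using assms null_null[of x u y u'] by (intro QI[of x y u u']) (auto simp: add_mset_commute)

text \<open>Regrouped as (x u)(y u'), the representative belongs to the class of x u and v', which
  is already settled.\<close>

lemma Q_step:
  assumes "Q x u v'" "third y u' = Some v'" "third x u = None" "third u u' = Some v" "third x y = None"
    "{x, y, u, u'} \<subseteq> V"
  shows "Q x y v"
proof (rule QI)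
  have "P {#x, u, y, u'#}"
    using assms by (simp add: Q_def)
  then show "P {#x, y, u, u'#}"
    by (simp add: add_mset_commute)
qed (use assms in auto)

text \<open>Both classes contain the product of x with the term y y' z: it can be read as (x y)(y'
  z) or as (x y')(y z).\<close>

lemma Q_link_imp:
  assumes "Q x y y" "third y y' = Some z" "third x y = None" "third x y' = None" "{x, y, y', z} \<subseteq> V"
  shows "Q x y' y'"
proof (rule QI)
  have "third y' z = Some y"
    using assms third_rotate[of y' y z] by (simp add: third_commute)
  then have "P {#x, y, y', z#}"
    using assms by (simp add: Q_def)
  then show "P {#x, y', y, z#}"
    by (simp add: add_mset_commute)
qed (use assms third_rotate[of y y' z] in auto)

lemma Q_link:
  assumes "third y y' = Some z" "third x y = None" "third x y' = None" "{x, y, y', z} \<subseteq> V"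
  shows "Q x y y \<longleftrightarrow> Q x y' y'"
  using assms Q_link_imp[of x y y' z] Q_link_imp[of x y' y z] third_commute[of y y'] by auto

text \<open>
  A product \<open>x y u v\<close> is settled when \<open>x u\<close> and \<open>y v\<close> are also null.  For \<open>third u v\<close> different
  from \<open>x\<close> and \<open>y\<close> such \<open>u, v\<close> exist except for a few local configurations \<open>x, y\<close>, where only \<open>x u\<close> can be
  made null and \<open>y v\<close> has to be exchanged once more.
\<close>

lemma Q_A:
  assumes xy: "third x y = None" "{x, y} \<subseteq> V" "x \<noteq> VA i" "y \<noteq> VA i" "x \<noteq> VD \<or> y \<noteq> VD" and i: "i < m"
  shows "Q x y (VA i)"
proof -
  define ex where "ex x y \<longleftrightarrow> x = VA (nxt i) \<and> (y = VB i \<or> y = VC i) \<or> x = VA (nxt (nxt i)) \<and> y = VB i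
    \<or> x = VA (prv i) \<and> y = VB (nxt i) \<or> x = VB (nxt (nxt i)) \<and> y = VB i \<or> x = VC (nxt i) \<and> y = VB i
    \<or> x = VC i \<and> y = VB (nxt i)" for x y
  let ?free = "\<lambda>u v. third x u = None \<and> third y v = None"
  have exceptional: "Q x y (VA i)" if "ex x y" for x y
    using that i unfolding ex_def
    apply (elim disjE conjE)
    subgoal
      by (rule Q_step[OF Q_free[of _ "VC (prv i)" _ "VC i"], where u = "VA (prv i)" and u' = "VA i"])
        (auto simp: cyc3_def)
    subgoal
      by (rule Q_commute, rule Q_step[OF Q_free[of _ "VA (nxt (nxt i))" _ "VA (nxt (nxt i))"], where u = "VA (prv i)" and u' = "VA i"])
        (auto simp: cyc3_def)
    subgoal
      by (rule Q_step[OF Q_free[of _ "VC (prv i)" _ "VC i"], where u = "VA (prv i)" and u' = "VA i"])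
        (auto simp: cyc3_def)
    subgoal
      by (rule Q_step[OF Q_free[of _ "VC (nxt i)" _ "VC i"], where u = "VA (nxt i)" and u' = "VA (nxt i)"])
        (auto simp: cyc3_def)
    subgoal
      by (rule Q_step[OF Q_free[of _ "VC (prv i)" _ "VC i"], where u = "VA (prv i)" and u' = "VA i"])
        (auto simp: cyc3_def)
    subgoal
      by (rule Q_step[OF Q_free[of _ "VC (prv i)" _ "VC i"], where u = "VA (prv i)" and u' = "VA i"])
        (auto simp: cyc3_def)
    subgoal
      by (rule Q_step[OF Q_free[of _ "VC (nxt (nxt i))" _ "VC (nxt (nxt i))"], where u = "VA (nxt i)" and u' = "VA (nxt i)"])
        (auto simp: cyc3_def)
    done
  \<comment> \<open>The pairs with third variable \<open>VA i\<close> are b_i c_i, a_{i+1}^2,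
    a_{i-1} a_i and b_{i+1} d; they are tried in both orders.\<close>
  have "?free (VB i) (VC i) \<or> ?free (VC i) (VB i) \<or> ?free (VA (nxt i)) (VA (nxt i))
    \<or> ?free (VA (prv i)) (VA i) \<or> ?free (VA i) (VA (prv i)) \<or> ?free (VB (nxt i)) VD \<or> ?free VD (VB (nxt i))
    \<or> ex x y \<or> ex y x"
    using xy(1,3-5) unfolding ex_def
    by (cases x; cases y; simp add: cyc3_def; force split: if_splits)
  moreover have free: "Q x y (VA i)" if "?free u v" "third u v = Some (VA i)" "{u, v} \<subseteq> V" for u v
    using that xy by (intro Q_free) auto
  ultimately show ?thesis
    using i exceptional Q_commute[OF exceptional] by (elim disjE; (erule free)?) (auto simp: cyc3_def)
qed

lemma Q_B:
  assumes xy: "third x y = None" "{x, y} \<subseteq> V" "x \<noteq> VB i" "y \<noteq> VB i" "x \<noteq> VD \<or> y \<noteq> VD" and i: "i < m"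
  shows "Q x y (VB i)"
proof -
  define ex where "ex x y \<longleftrightarrow> x = VB (prv i) \<and> y = VA i \<or> x = VA (prv i) \<and> (y = VA (nxt i) \<or> y = VB (nxt i))" for x y
  let ?free = "\<lambda>u v. third x u = None \<and> third y v = None"
  have exceptional: "Q x y (VB i)" if "ex x y" for x y
    using that i unfolding ex_def
    apply (elim disjE conjE)
    subgoal
      by (rule Q_step[OF Q_free[of _ "VA (nxt (nxt i))" _ "VB (nxt (nxt (nxt i)))"], where u = "VB (nxt i)" and u' = "VB (nxt i)"])
        (auto simp: cyc3_def)
    subgoal
      by (rule Q_step[OF Q_free[of _ "VA (nxt (nxt i))" _ "VA (nxt (nxt i))"], where u = "VC i" and u' = "VA i"])
        (auto simp: cyc3_def)
    subgoal
      by (rule Q_step[OF Q_free[of _ "VA (nxt i)" _ "VB (nxt (nxt i))"], where u = "VC i" and u' = "VA i"])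
        (auto simp: cyc3_def)
    done
  have "?free (VA i) (VC i) \<or> ?free (VC i) (VA i) \<or> ?free (VB (nxt i)) (VB (nxt i))
    \<or> ?free (VB (prv i)) (VB i) \<or> ?free (VB i) (VB (prv i)) \<or> ?free (VA (prv i)) VD \<or> ?free VD (VA (prv i))
    \<or> ex x y \<or> ex y x"
    using xy(1,3-5) unfolding ex_def
    by (cases x; cases y; simp add: cyc3_def; force split: if_splits)
  moreover have free: "Q x y (VB i)" if "?free u v" "third u v = Some (VB i)" "{u, v} \<subseteq> V" for u v
    using that xy by (intro Q_free) auto
  ultimately show ?thesis
    using i exceptional Q_commute[OF exceptional] by (elim disjE; (erule free)?) (auto simp: cyc3_def)
qed

lemma Q_C:
  assumes xy: "third x y = None" "{x, y} \<subseteq> V" "x \<noteq> VC i" "y \<noteq> VC i" and i: "i < m"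
  shows "Q x y (VC i)"
proof -
  define ex where "ex x y \<longleftrightarrow> x = VC (nxt i) \<and> (y = VA i \<or> y = VB i) \<or> x = VC (prv i) \<and> y = VB (nxt i)" for x y
  let ?free = "\<lambda>u v. third x u = None \<and> third y v = None"
  have exceptional: "Q x y (VC i)" if "ex x y" for x y
    using that i unfolding ex_def
    apply (elim disjE conjE)
    subgoal
      by (rule Q_step[OF Q_free[of _ "VA (prv i)" _ "VA (prv (prv i))"], where u = "VB i" and u' = "VA i"])
        (auto simp: cyc3_def)
    subgoal
      by (rule Q_step[OF Q_free[of _ "VA (prv i)" _ "VA i"], where u = "VC (prv i)" and u' = "VC i"])
        (auto simp: cyc3_def)
    subgoal
      by (rule Q_step[OF Q_free[of _ "VA (nxt i)" _ "VB (nxt (nxt i))"], where u = "VB i" and u' = "VA i"])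
        (auto simp: cyc3_def)
    done
  have "?free (VA i) (VB i) \<or> ?free (VB i) (VA i) \<or> ?free (VC (nxt i)) (VC (nxt i))
    \<or> ?free (VC (prv i)) (VC i) \<or> ?free (VC i) (VC (prv i)) \<or> ex x y \<or> ex y x"
    using xy(1,3-4) unfolding ex_def
    by (cases x; cases y; simp add: cyc3_def; force split: if_splits)
  moreover have free: "Q x y (VC i)" if "?free u v" "third u v = Some (VC i)" "{u, v} \<subseteq> V" for u v
    using that xy by (intro Q_free) auto
  ultimately show ?thesis
    using i exceptional Q_commute[OF exceptional] by (elim disjE; (erule free)?) (auto simp: cyc3_def)
qed

text \<open>The pairs with third variable \<open>VD\<close> are \<open>VA k\<close> and
  \<open>VB (nxt k)\<close>, one for each of the m indices. With a suitable choice of which of x and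
  y meets \<open>VA k\<close>, at most five values of k are blocked.\<close>

lemma Q_D:
  assumes xy: "third x y = None" "{x, y} \<subseteq> V" "x \<noteq> VD" "y \<noteq> VD"
  shows "Q x y VD"
proof -
  have "\<exists>i<m. third x (VA i) = None \<and> third y (VB (nxt i)) = None \<or> third y (VA i) = None \<and> third x (VB (nxt i)) = None"
  proof (cases x)
    case [simp]: (VA j)
    show ?thesis
    proof (cases y)
      case [simp]: (VA l)
      obtain k where "k < m" "k \<notin> {j, nxt j, prv j, l, prv l}"
        by (rule avoid5[of j "nxt j" "prv j" l "prv l"]) simp
      then show ?thesis
        by (intro exI[of _ k]) (auto simp: cyc3_def)
    next
      case [simp]: (VB l)
      obtain k where "k < m" "k \<notin> {j, prv j, l, prv l, l}"
        by (rule avoid5[of j "prv j" l "prv l" l]) simp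
      then show ?thesis
        by (intro exI[of _ k]) (auto simp: cyc3_def)
    next
      case [simp]: (VC l)
      obtain k where "k < m" "k \<notin> {j, prv j, l, l, l}"
        by (rule avoid5[of j "prv j" l l l]) simp
      then show ?thesis
        by (intro exI[of _ k]) (auto simp: cyc3_def)
    qed (use xy in simp)
  next
    case [simp]: (VB j)
    show ?thesis
    proof (cases y)
      case [simp]: (VA l)
      obtain k where "k < m" "k \<notin> {j, prv j, l, prv l, l}"
        by (rule avoid5[of j "prv j" l "prv l" l]) simp
      then show ?thesis
        by (intro exI[of _ k]) (auto simp: cyc3_def)
    next
      case [simp]: (VB l)
      obtain k where "k < m" "k \<notin> {j, prv j, l, prv l, prv (prv l)}"
        by (rule avoid5[of j "prv j" l "prv l" "prv (prv l)"]) simp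
      then show ?thesis
        by (intro exI[of _ k]) (auto simp: cyc3_def)
    next
      case [simp]: (VC l)
      obtain k where "k < m" "k \<notin> {j, prv j, prv l, l, l}"
        by (rule avoid5[of j "prv j" "prv l" l l]) simp
      then show ?thesis
        by (intro exI[of _ k]) (auto simp: cyc3_def)
    qed (use xy in simp)
  next
    case [simp]: (VC j)
    show ?thesis
    proof (cases y)
      case [simp]: (VA l)
      obtain k where "k < m" "k \<notin> {j, prv l, l, j, j}"
        by (rule avoid5[of j "prv l" l j j]) simp
      then show ?thesis
        by (intro exI[of _ k]) (auto simp: cyc3_def)
    next
      case [simp]: (VB l)
      obtain k where "k < m" "k \<notin> {prv j, prv l, l, j, j}"
        by (rule avoid5[of "prv j" "prv l" l j j]) simp
      then show ?thesis
        by (intro exI[of _ k]) (auto simp: cyc3_def)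
    next
      case [simp]: (VC l)
      obtain k where "k < m" "k \<notin> {j, prv l, l, j, j}"
        by (rule avoid5[of j "prv l" l j j]) simp
      then show ?thesis
        by (intro exI[of _ k]) (auto simp: cyc3_def)
    qed (use xy in simp)
  qed (use xy in simp)
  then obtain i where "i < m" "third x (VA i) = None \<and> third y (VB (nxt i)) = None \<or> third y (VA i) = None \<and> third x (VB (nxt i)) = None"
    by blast
  then show ?thesis
    using xy by (elim disjE) (auto intro: Q_free[of x "VA i" y "VB (nxt i)"] Q_free[of x "VB (nxt i)" y "VA i"] simp: third_commute[of y])
qed

lemma Q_notin:
  assumes "third x y = None" "{x, y, v} \<subseteq> V" "v \<noteq> x" "v \<noteq> y" "x \<noteq> VD \<or> y \<noteq> VD"
  shows "Q x y v"
  using assms by (cases v) (auto intro!: Q_A Q_B Q_C Q_D)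

lemma Q_start:
  assumes "x \<in> V"
  obtains y where "third x y = None" "y \<noteq> x" "y \<in> V" "Q x y y"
proof -
  obtain y z w where "third x y = None" "y \<noteq> x" "third z w = Some y" "{y, z, w} \<subseteq> V" "P {#x, y, z, w#}"
    using start[OF assms] by blast
  then show thesis
    using that[of y] QI[of x y z w y] assms by auto
qed

text \<open>\<open>start\<close> settles the class for one null partner of x; if all partners share
  the status of a common hub h, they are all settled.\<close>

lemma Q_right_if_hub:
  assumes "x \<in> V" "\<And>y. third x y = None \<Longrightarrow> y \<noteq> x \<Longrightarrow> y \<in> V \<Longrightarrow> Q x y y \<longleftrightarrow> Q x h h"
    and "third x y = None" "y \<noteq> x" "y \<in> V"
  shows "Q x y y"
  using Q_start[of x] assms by metis

text \<open>The \<open>VC j\<close> with j different from i are null with x and form a path linked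
  by the terms c_j c_{j+1}^2. A null partner \<open>VA j\<close> or \<open>VB j\<close> is attached
  to this path by a_j b_j c_j.\<close>

lemma Q_right_AB:
  assumes x: "x = VA i \<or> x = VB i" "i < m" and y: "third x y = None" "y \<noteq> x" "y \<in> V"
  shows "Q x y y"
proof (rule Q_right_if_hub[of x "VC (nxt i)"])
  have C: "Q x (VC j) (VC j) \<longleftrightarrow> Q x (VC (nxt i)) (VC (nxt i))" if "j < m" "j \<noteq> i" for j
  proof (rule cyclic_induct[where R = "\<lambda>j. Q x (VC j) (VC j)"])
    fix l
    assume "l < m" "l \<noteq> i" "nxt l \<noteq> i"
    then show "Q x (VC l) (VC l) \<longleftrightarrow> Q x (VC (nxt l)) (VC (nxt l))"
      using x by (intro Q_link[of _ _ "VC (nxt l)"]) (auto simp: cyc3_def)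
  qed (use that x in auto)
  fix y
  assume y: "third x y = None" "y \<noteq> x" "y \<in> V"
  show "Q x y y \<longleftrightarrow> Q x (VC (nxt i)) (VC (nxt i))"
  proof (cases y)
    case (VA j)
    with x y have "j \<noteq> i"
      by (auto simp: cyc3_def split: if_splits)
    with x y VA have "Q x y y \<longleftrightarrow> Q x (VC j) (VC j)"
      by (intro Q_link[of _ _ "VB j"]) (auto simp: cyc3_def split: if_splits)
    with \<open>j \<noteq> i\<close> C[of j] y VA show ?thesis by simp
  next
    case (VB j)
    with x y have "j \<noteq> i"
      by (auto simp: cyc3_def split: if_splits)
    with x y VB have "Q x y y \<longleftrightarrow> Q x (VC j) (VC j)"
      by (intro Q_link[of _ _ "VA j"]) (auto simp: cyc3_def split: if_splits)
    with \<open>j \<noteq> i\<close> C[of j] y VB show ?thesis by simp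
  next
    case (VC j)
    with x y have "j \<noteq> i"
      by auto
    with C[of j] y VC show ?thesis by simp
  qed (use x y in auto)
qed (use x y in auto)

text \<open>Here \<open>VD\<close> is null with x and is the hub: a_j b_{j+1} d links it to every
  \<open>VA j\<close> with j different from i, and a_j b_j c_j links \<open>VA j\<close> to
  \<open>VB j\<close> and \<open>VC j\<close>.\<close>

lemma Q_right_C:
  assumes i: "i < m" and y: "third (VC i) y = None" "y \<noteq> VC i" "y \<in> V"
  shows "Q (VC i) y y"
proof (rule Q_right_if_hub[of _ VD])
  have A: "Q (VC i) (VA j) (VA j) \<longleftrightarrow> Q (VC i) VD VD" if "j < m" "j \<noteq> i" for j
    using that i by (intro Q_link[of _ _ "VB (nxt j)"]) (auto simp: cyc3_def)
  fix y
  assume y: "third (VC i) y = None" "y \<noteq> VC i" "y \<in> V"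
  show "Q (VC i) y y \<longleftrightarrow> Q (VC i) VD VD"
  proof (cases y)
    case (VB j)
    with i y have "j \<noteq> i"
      by (auto simp: cyc3_def split: if_splits)
    with i y VB have "Q (VC i) y y \<longleftrightarrow> Q (VC i) (VA j) (VA j)"
      by (intro Q_link[of _ _ "VC j"]) (auto simp: cyc3_def split: if_splits)
    with \<open>j \<noteq> i\<close> A y VB show ?thesis by auto
  next
    case (VC j)
    with i y have "j \<noteq> i"
      by (auto simp: cyc3_def split: if_splits)
    with i y VC have "Q (VC i) y y \<longleftrightarrow> Q (VC i) (VA j) (VA j)"
      by (intro Q_link[of _ _ "VB j"]) (auto simp: cyc3_def split: if_splits)
    with \<open>j \<noteq> i\<close> A y VC show ?thesis by auto
  qed (use i y A in \<open>auto split: if_splits\<close>)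
qed (use i y in auto)

text \<open>The null partners of \<open>VD\<close> other than itself are the \<open>VC j\<close>,
  linked around the full cycle. \<open>cyclic_induct\<close> at 0 covers the nonzero j, and one
  further link joins 0 to \<open>nxt 0\<close>.\<close>

lemma Q_right_D:
  assumes y: "third VD y = None" "y \<noteq> VD" "y \<in> V"
  shows "Q VD y y"
proof (rule Q_right_if_hub[of _ "VC (nxt 0)"])
  have step: "Q VD (VC j) (VC j) \<longleftrightarrow> Q VD (VC (nxt j)) (VC (nxt j))" if "j < m" for j
    using that by (intro Q_link[of _ _ "VC (nxt j)"]) (auto simp: cyc3_def)
  have C: "Q VD (VC j) (VC j) \<longleftrightarrow> Q VD (VC (nxt 0)) (VC (nxt 0))" if "j < m" for j
  proof (cases "j = 0")
    case False
    show ?thesis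
      by (rule cyclic_induct[where R = "\<lambda>j. Q VD (VC j) (VC j)", OF step]) (use that False m6 in auto)
  qed (use step[of 0] m6 in simp)
  show "Q VD y y \<longleftrightarrow> Q VD (VC (nxt 0)) (VC (nxt 0))" if "third VD y = None" "y \<noteq> VD" "y \<in> V" for y
  proof (cases y)
    case (VC j)
    with C[of j] that show ?thesis by simp
  qed (use that in auto)
qed (use y in auto)

lemma Q_right: "third x y = None \<Longrightarrow> y \<noteq> x \<Longrightarrow> {x, y} \<subseteq> V \<Longrightarrow> Q x y y"
  by (cases x) (auto intro: Q_right_AB Q_right_C Q_right_D)

text \<open>If v is neither x nor y, a local exchange settles the class; if it is one of them, the
  walk around the cycle does.\<close>

lemma Q_distinct: "third x y = None \<Longrightarrow> x \<noteq> y \<Longrightarrow> {x, y, v} \<subseteq> V \<Longrightarrow> Q x y v"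
  by (metis Q_notin Q_right Q_commute third_commute insert_subset subset_insertI)

lemma P_distinct:
  assumes "third x y = None" "x \<noteq> y" "{x, y, z, w} \<subseteq> V"
  shows "P {#x, y, z, w#}"
proof (cases "third z w")
  case (Some v)
  then have "v \<in> V"
    using assms third_in_V by auto
  with Q_distinct[of x y v] assms Some show ?thesis
    by (auto simp: Q_def)
qed (use assms null_null in auto)

text \<open>\<open>VD\<close> is the only variable with a null square, and the walk above only
  reaches null pairs of distinct variables.\<close>

lemma P_DD:
  assumes "{z, w} \<subseteq> V"
  shows "P {#VD, VD, z, w#}"
proof (cases "third z w")
  case (Some v)
  then have v: "v \<in> V"
    using assms third_in_V by auto
  have "Q VD VD v"
  proof (cases v)
    case (VA i)
    with v show ?thesis
      by (intro Q_step[OF Q_distinct, where u = "VC i" and u' = "VB i" and v' = "VA (prv i)"]) auto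
  next
    case (VB i)
    with v show ?thesis
      by (intro Q_step[OF Q_distinct, where u = "VC i" and u' = "VA i" and v' = "VB (nxt i)"]) auto
  next
    case (VC i)
    with v show ?thesis
      by (intro Q_free[where u = "VC (nxt i)" and u' = "VC (nxt i)"]) (auto simp: cyc3_def)
  next
    case VD
    \<comment> \<open>The three other terms of (d a_0 - a_1 c_1)(d b_1 - b_0 c_0), whose first term
      is d^2 a_0 b_1. Each contains a null pair of distinct variables.\<close>
    have "P {#VC 0, VD, VA 0, VB 0#}" "P {#VC 1, VD, VA 1, VB 1#}"
      "P {#VA 1, VC 0, VC 1, VB 0#}"
      using m6 by (auto intro!: P_distinct)
    moreover have s0: "nxt 0 = 1" "prv 1 = 0"
      using m6 nxt_prv[of 1] by (simp_all add: nxt_def prv_def)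
    ultimately have "P {#VD, VA 0, VD, VB 1#}"
      using m6 by (intro swap_swap[of VD "VA 0" "VA 1" "VC 1" VD "VB 1" "VB 0" "VC 0"])
        (auto simp: add_mset_commute)
    then have "P {#VD, VD, VA 0, VB 1#}"
      by (simp add: add_mset_commute)
    with VD m6 s0 show ?thesis
      by (intro QI[of _ _ "VA 0" "VB 1"]) auto
  qed
  with assms Some show ?thesis
    by (auto simp: Q_def)
qed (use assms null_null in auto)

lemma P_null:
  assumes "third x y = None" "{x, y, z, w} \<subseteq> V"
  shows "P {#x, y, z, w#}"
proof (cases "x = y")
  case True
  with assms show ?thesis
    by (cases x) (auto simp: cyc3_def P_DD)
qed (use assms P_distinct in auto)

section \<open>Products without a null pair\<close>

definition some_null :: "vars \<Rightarrow> vars \<Rightarrow> vars \<Rightarrow> vars \<Rightarrow> bool"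
  where "some_null x y z w \<longleftrightarrow> third x y = None \<or> third x z = None \<or> third x w = None
    \<or> third y z = None \<or> third y w = None \<or> third z w = None"

lemma P_some_null:
  assumes "some_null x y z w" "{x, y, z, w} \<subseteq> V"
  shows "P {#x, y, z, w#}"
  using assms P_null[of x y z w] P_null[of x z y w] P_null[of x w y z]
    P_null[of y z x w] P_null[of y w x z] P_null[of z w x y]
  by (auto simp: some_null_def add_mset_commute)

text \<open>\<open>swap_swap\<close> as a certificate: all its side conditions become finite
  comparisons of indices.\<close>

lemma P_swap:
  assumes "third x y \<noteq> None" "third x y = third x' y'" "third z w \<noteq> None" "third z w = third z' w'"
    "{x, y, x', y', z, w, z', w'} \<subseteq> V"
    "some_null x y z' w'" "some_null x' y' z w" "some_null x' y' z' w'"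
  shows "P {#x, y, z, w#}"
  by (rule swap_swap[OF assms(1-5)]) (use assms P_some_null in auto)

text \<open>
  Up to rotation, the monomials without null pair, apart from those of \<open>P_cube\<close>.  The replacements were found by a
  search for a product of differences whose three other terms all contain a null pair.
\<close>

lemma P_clique_table:
  "i < m \<Longrightarrow> P {#VA i, VA i, VA i, VA i#}"
  "i < m \<Longrightarrow> P {#VA i, VA (nxt i), VA i, VA i#}"
  "i < m \<Longrightarrow> P {#VA i, VB i, VA i, VA i#}"
  "i < m \<Longrightarrow> P {#VA i, VA i, VA i, VB (nxt i)#}"
  "i < m \<Longrightarrow> P {#VA i, VC i, VA i, VA i#}"
  "i < m \<Longrightarrow> P {#VA i, VA i, VA i, VD#}"
  "i < m \<Longrightarrow> P {#VA i, VA (nxt i), VA i, VA (nxt i)#}"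
  "i < m \<Longrightarrow> P {#VA i, VA i, VA (nxt i), VB (nxt i)#}"
  "i < m \<Longrightarrow> P {#VA i, VA (nxt i), VA i, VD#}"
  "i < m \<Longrightarrow> P {#VA i, VB i, VA i, VA (prv i)#}"
  "i < m \<Longrightarrow> P {#VA i, VA (prv i), VA i, VD#}"
  "i < m \<Longrightarrow> P {#VA i, VB i, VA i, VB i#}"
  "i < m \<Longrightarrow> P {#VA i, VA i, VB i, VB (nxt i)#}"
  "i < m \<Longrightarrow> P {#VA i, VB i, VA i, VC i#}"
  "i < m \<Longrightarrow> P {#VA i, VA i, VB i, VD#}"
  "i < m \<Longrightarrow> P {#VA i, VA i, VB (nxt i), VB (nxt i)#}"
  "i < m \<Longrightarrow> P {#VA i, VD, VA i, VB (nxt i)#}"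
  "i < m \<Longrightarrow> P {#VA i, VC i, VA i, VC i#}"
  "i < m \<Longrightarrow> P {#VA i, VB i, VA (prv i), VB i#}"
  "i < m \<Longrightarrow> P {#VA i, VA (prv i), VB i, VD#}"
  "i < m \<Longrightarrow> P {#VA i, VB i, VB i, VB i#}"
  "i < m \<Longrightarrow> P {#VA i, VB i, VB i, VB (nxt i)#}"
  "i < m \<Longrightarrow> P {#VA i, VB i, VB i, VC i#}"
  "i < m \<Longrightarrow> P {#VA i, VB i, VB i, VD#}"
  "i < m \<Longrightarrow> P {#VA i, VB i, VB (nxt i), VB (nxt i)#}"
  "i < m \<Longrightarrow> P {#VA i, VD, VB i, VB (nxt i)#}"
  "i < m \<Longrightarrow> P {#VA i, VC i, VB i, VC i#}"
  "i < m \<Longrightarrow> P {#VA i, VC i, VC i, VC i#}"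
  "i < m \<Longrightarrow> P {#VA (prv i), VB i, VB i, VB i#}"
  "i < m \<Longrightarrow> P {#VA (prv i), VB i, VB i, VD#}"
  "i < m \<Longrightarrow> P {#VB i, VB i, VB i, VB i#}"
  "i < m \<Longrightarrow> P {#VB i, VB (nxt i), VB i, VB i#}"
  "i < m \<Longrightarrow> P {#VB i, VC i, VB i, VB i#}"
  "i < m \<Longrightarrow> P {#VB i, VB i, VB i, VD#}"
  "i < m \<Longrightarrow> P {#VB i, VB (nxt i), VB i, VB (nxt i)#}"
  "i < m \<Longrightarrow> P {#VB i, VD, VB i, VB (nxt i)#}"
  "i < m \<Longrightarrow> P {#VB i, VB (prv i), VB i, VD#}"
  "i < m \<Longrightarrow> P {#VB i, VC i, VB i, VC i#}"
  "i < m \<Longrightarrow> P {#VB i, VC i, VC i, VC i#}"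
  "i < m \<Longrightarrow> P {#VC i, VC i, VC i, VC i#}"
  "i < m \<Longrightarrow> P {#VC i, VC i, VC i, VC (nxt i)#}"
  "i < m \<Longrightarrow> P {#VC i, VC (nxt i), VC i, VC (nxt i)#}"
  subgoal premises i
    by (rule P_swap[of "VA i" "VA i" "VA (prv (prv i))" "VA (prv i)" "VA i" "VA i" "VB (prv i)" "VC (prv i)"])
      (use i in \<open>auto simp: cyc3_def some_null_def\<close>)
  subgoal premises i
    by (rule P_swap[of "VA i" "VA (nxt i)" "VB (nxt i)" "VC (nxt i)" "VA i" "VA i" "VB i" VD])
      (use i in \<open>auto simp: cyc3_def some_null_def\<close>)
  subgoal premises i
    by (rule P_swap[of "VA i" "VB i" "VC i" "VC (prv i)" "VA i" "VA i" "VB (prv i)" "VC (prv i)"])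
      (use i in \<open>auto simp: cyc3_def some_null_def\<close>)
  subgoal premises i
    by (rule P_swap[of "VA i" "VA i" "VB (prv i)" "VC (prv i)" "VA i" "VB (nxt i)" "VA (nxt i)" "VB (nxt (nxt i))"])
      (use i in \<open>auto simp: cyc3_def some_null_def\<close>)
  subgoal premises i
    by (rule P_swap[of "VA i" "VC i" "VB i" "VB (prv i)" "VA i" "VA i" "VB (prv i)" "VC (prv i)"])
      (use i in \<open>auto simp: cyc3_def some_null_def\<close>)
  subgoal premises i
    by (rule P_swap[of "VA i" "VA i" "VB i" VD "VA i" VD "VA (nxt i)" "VC (nxt i)"])
      (use i in \<open>auto simp: cyc3_def some_null_def\<close>)
  subgoal premises i
    by (rule P_swap[of "VA i" "VA (nxt i)" "VB (nxt i)" "VC (nxt i)" "VA i" "VA (nxt i)" "VB (nxt (nxt i))" VD])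
      (use i in \<open>auto simp: cyc3_def some_null_def\<close>)
  subgoal premises i
    by (rule P_swap[of "VA i" "VA i" "VB i" VD "VA (nxt i)" "VB (nxt i)" "VC i" "VC (nxt i)"])
      (use i in \<open>auto simp: cyc3_def some_null_def\<close>)
  subgoal premises i
    by (rule P_swap[of "VA i" "VA (nxt i)" "VB (nxt i)" "VC (nxt i)" "VA i" VD "VB i" "VB (nxt i)"])
      (use i in \<open>auto simp: cyc3_def some_null_def\<close>)
  subgoal premises i
    by (rule P_swap[of "VA i" "VB i" "VC i" "VC (prv i)" "VA i" "VA (prv i)" "VA (nxt i)" "VA (nxt i)"])
      (use i in \<open>auto simp: cyc3_def some_null_def\<close>)
  subgoal premises i
    by (rule P_swap[of "VA i" "VA (prv i)" "VB i" "VC i" "VA i" VD "VB i" "VB (nxt i)"])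
      (use i in \<open>auto simp: cyc3_def some_null_def\<close>)
  subgoal premises i
    by (rule P_swap[of "VA i" "VB i" "VC i" "VC (prv i)" "VA i" "VB i" "VC (nxt i)" "VC (nxt i)"])
      (use i in \<open>auto simp: cyc3_def some_null_def\<close>)
  subgoal premises i
    by (rule P_swap[of "VA i" "VA i" "VB (prv i)" "VC (prv i)" "VB i" "VB (nxt i)" "VA (nxt i)" "VC (nxt i)"])
      (use i in \<open>auto simp: cyc3_def some_null_def\<close>)
  subgoal premises i
    by (rule P_swap[of "VA i" "VB i" "VC i" "VC (prv i)" "VA i" "VC i" "VB i" "VB (prv i)"])
      (use i in \<open>auto simp: cyc3_def some_null_def\<close>)
  subgoal premises i
    by (rule P_swap[of "VA i" "VA i" "VB i" VD "VB i" VD "VB (prv i)" "VC (prv i)"])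
      (use i in \<open>auto simp: cyc3_def some_null_def\<close>)
  subgoal premises i
    by (rule P_swap[of "VA i" "VA i" "VB (prv i)" "VC (prv i)" "VB (nxt i)" "VB (nxt i)" "VB i" "VB (prv i)"])
      (use i in \<open>auto simp: cyc3_def some_null_def\<close>)
  subgoal premises i
    by (rule P_swap[of "VA i" VD "VA (nxt i)" "VC (nxt i)" "VA i" "VB (nxt i)" "VA (nxt i)" "VB (nxt (nxt i))"])
      (use i in \<open>auto simp: cyc3_def some_null_def\<close>)
  subgoal premises i
    by (rule P_swap[of "VA i" "VC i" "VA (prv i)" VD "VA i" "VC i" "VA (prv i)" VD])
      (use i in \<open>auto simp: cyc3_def some_null_def\<close>)
  subgoal premises i
    by (rule P_swap[of "VA i" "VB i" "VC i" "VC (prv i)" "VA (prv i)" "VB i" "VA (nxt i)" "VB (nxt (nxt i))"])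
      (use i in \<open>auto simp: cyc3_def some_null_def\<close>)
  subgoal premises i
    by (rule P_swap[of "VA i" "VA (prv i)" "VB i" "VC i" "VB i" VD "VB (prv i)" "VC (prv i)"])
      (use i in \<open>auto simp: cyc3_def some_null_def\<close>)
  subgoal premises i
    by (rule P_swap[of "VA i" "VB i" "VC i" "VC (prv i)" "VB i" "VB i" "VA (prv (prv i))" VD])
      (use i in \<open>auto simp: cyc3_def some_null_def\<close>)
  subgoal premises i
    by (rule P_swap[of "VA i" "VB i" "VC i" "VC (prv i)" "VB i" "VB (nxt i)" "VA (nxt i)" "VC (nxt i)"])
      (use i in \<open>auto simp: cyc3_def some_null_def\<close>)
  subgoal premises i
    by (rule P_swap[of "VA i" "VB i" "VC i" "VC (prv i)" "VB i" "VC i" "VA (nxt i)" "VA (nxt i)"])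
      (use i in \<open>auto simp: cyc3_def some_null_def\<close>)
  subgoal premises i
    by (rule P_swap[of "VA i" "VB i" "VC i" "VC (prv i)" "VB i" VD "VB (prv i)" "VC (prv i)"])
      (use i in \<open>auto simp: cyc3_def some_null_def\<close>)
  subgoal premises i
    by (rule P_swap[of "VA i" "VB i" "VC i" "VC (prv i)" "VB (nxt i)" "VB (nxt i)" "VB i" "VB (prv i)"])
      (use i in \<open>auto simp: cyc3_def some_null_def\<close>)
  subgoal premises i
    by (rule P_swap[of "VA i" VD "VA (nxt i)" "VC (nxt i)" "VB i" "VB (nxt i)" "VA i" VD])
      (use i in \<open>auto simp: cyc3_def some_null_def\<close>)
  subgoal premises i
    by (rule P_swap[of "VA i" "VC i" "VA (prv i)" VD "VB i" "VC i" "VB (nxt i)" VD])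
      (use i in \<open>auto simp: cyc3_def some_null_def\<close>)
  subgoal premises i
    by (rule P_swap[of "VA i" "VC i" "VA (prv i)" VD "VC i" "VC i" "VC (prv (prv i))" "VC (prv i)"])
      (use i in \<open>auto simp: cyc3_def some_null_def\<close>)
  subgoal premises i
    by (rule P_swap[of "VA (prv i)" "VB i" "VA (nxt i)" "VB (nxt (nxt i))" "VB i" "VB i" "VA (prv (prv i))" VD])
      (use i in \<open>auto simp: cyc3_def some_null_def\<close>)
  subgoal premises i
    by (rule P_swap[of "VA (prv i)" "VB i" "VA (nxt i)" "VB (nxt (nxt i))" "VB i" VD "VB (prv i)" "VC (prv i)"])
      (use i in \<open>auto simp: cyc3_def some_null_def\<close>)
  subgoal premises i
    by (rule P_swap[of "VB i" "VB i" "VA (prv (prv i))" VD "VB i" "VB i" "VA (prv (prv i))" VD])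
      (use i in \<open>auto simp: cyc3_def some_null_def\<close>)
  subgoal premises i
    by (rule P_swap[of "VB i" "VB (nxt i)" "VA (nxt i)" "VC (nxt i)" "VB i" "VB i" "VA (prv (prv i))" VD])
      (use i in \<open>auto simp: cyc3_def some_null_def\<close>)
  subgoal premises i
    by (rule P_swap[of "VB i" "VC i" "VA (nxt i)" "VA (nxt i)" "VB i" "VB i" "VA (prv (prv i))" VD])
      (use i in \<open>auto simp: cyc3_def some_null_def\<close>)
  subgoal premises i
    by (rule P_swap[of "VB i" "VB i" "VA (prv (prv i))" VD "VB i" VD "VB (prv i)" "VC (prv i)"])
      (use i in \<open>auto simp: cyc3_def some_null_def\<close>)
  subgoal premises i
    by (rule P_swap[of "VB i" "VB (nxt i)" "VA (nxt i)" "VC (nxt i)" "VB i" "VB (nxt i)" "VB (nxt (nxt i))" "VB (nxt (nxt i))"])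
      (use i in \<open>auto simp: cyc3_def some_null_def\<close>)
  subgoal premises i
    by (rule P_swap[of "VB i" VD "VB (prv i)" "VC (prv i)" "VB i" "VB (nxt i)" "VA i" VD])
      (use i in \<open>auto simp: cyc3_def some_null_def\<close>)
  subgoal premises i
    by (rule P_swap[of "VB i" "VB (prv i)" "VA i" "VC i" "VB i" VD "VB (prv i)" "VC (prv i)"])
      (use i in \<open>auto simp: cyc3_def some_null_def\<close>)
  subgoal premises i
    by (rule P_swap[of "VB i" "VC i" "VA i" "VA (prv i)" "VB i" "VC i" "VB (nxt i)" VD])
      (use i in \<open>auto simp: cyc3_def some_null_def\<close>)
  subgoal premises i
    by (rule P_swap[of "VB i" "VC i" "VA i" "VA (prv i)" "VC i" "VC i" "VA (prv i)" "VB (prv i)"])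
      (use i in \<open>auto simp: cyc3_def some_null_def\<close>)
  subgoal premises i
    by (rule P_swap[of "VC i" "VC i" "VA (prv i)" "VB (prv i)" "VC i" "VC i" "VC (prv (prv i))" "VC (prv i)"])
      (use i in \<open>auto simp: cyc3_def some_null_def\<close>)
  subgoal premises i
    by (rule P_swap[of "VC i" "VC i" "VA (prv i)" "VB (prv i)" "VC i" "VC (nxt i)" "VA (nxt i)" "VB (nxt i)"])
      (use i in \<open>auto simp: cyc3_def some_null_def\<close>)
  subgoal premises i
    by (rule P_swap[of "VC i" "VC (nxt i)" "VA (nxt i)" "VB (nxt i)" "VC i" "VC (nxt i)" "VC (nxt (nxt i))" "VC (nxt (nxt i))"])
      (use i in \<open>auto simp: cyc3_def some_null_def\<close>)
  done

text \<open>Here every product of differences has another term without null pair.\<close>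

lemma P_cube:
  assumes "C \<in> {VA, VB, VC}" "i < m"
  shows "P {#C i, C i, C i, C (prv i)#}"
proof (rule swap_swap[of "C i" "C i" "C (prv i)" "C (prv (prv i))" "C i" "C (prv i)" "C (nxt i)" "C (nxt i)"])
  show "P {#C i, C i, C (nxt i), C (nxt i)#}"
    using assms P_clique_table[of i] by (auto simp: add_mset_commute)
  show "P {#C (prv i), C (prv (prv i)), C i, C (prv i)#}" "P {#C (prv i), C (prv (prv i)), C (nxt i), C (nxt i)#}"
    using assms by (auto intro!: P_some_null simp: some_null_def cyc3_def)
qed (use assms in \<open>auto simp: cyc3_def\<close>)

text \<open>Without null pairs, y, z and w are among the five neighbours of \<open>VC i\<close>. The
  table is used at i and at both adjacent indices because its entries are listed up to
  rotation.\<close>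

lemma P_clique_C:
  assumes "\<not> some_null (VC i) y z w" "i < m"
  shows "P {#VC i, y, z, w#}"
proof -
  have i: "nxt i < m" "prv i < m"
    using assms by auto
  note F = P_clique_table[OF assms(2)] P_clique_table[OF i(1)] P_clique_table[OF i(2)]
    P_cube[of VC, OF _ assms(2), simplified insert_iff simp_thms] P_cube[of VC, OF _ i(1), simplified insert_iff simp_thms]
    P_cube[of VC, OF _ i(2), simplified insert_iff simp_thms]
  have nbr: "x \<in> {VC i, VC (nxt i), VC (prv i), VA i, VB i}" if "third (VC i) x \<noteq> None" for x
    using that by (cases x) (auto simp: cyc3_def split: if_splits)
  have "y \<in> {VC i, VC (nxt i), VC (prv i), VA i, VB i}" "z \<in> {VC i, VC (nxt i), VC (prv i), VA i, VB i}"
    "w \<in> {VC i, VC (nxt i), VC (prv i), VA i, VB i}"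
    using assms nbr unfolding some_null_def by blast+
  with assms(1) show ?thesis
    by (elim insertE emptyE; hypsubst; simp add: some_null_def cyc3_def)
      (simp_all only: F[simplified add_mset_commute nxt_prv prv_nxt] add_mset_commute)
qed

text \<open>With the factors \<open>VC\<close> left to \<open>P_clique_C\<close>, six neighbours of
  \<open>VA i\<close> remain.\<close>

lemma P_clique_A:
  assumes "\<not> some_null (VA i) y z w" "i < m" "{y, z, w} \<inter> range VC = {}"
  shows "P {#VA i, y, z, w#}"
proof -
  have i: "nxt i < m" "prv i < m"
    using assms by auto
  note F = P_clique_table[OF assms(2)] P_clique_table[OF i(1)] P_clique_table[OF i(2)]
    P_cube[of VA, OF _ assms(2), simplified insert_iff simp_thms] P_cube[of VA, OF _ i(1), simplified insert_iff simp_thms]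
    P_cube[of VA, OF _ i(2), simplified insert_iff simp_thms]
  have nbr: "x \<in> {VA i, VA (nxt i), VA (prv i), VB i, VB (nxt i), VD}" if "third (VA i) x \<noteq> None" "x \<notin> range VC" for x
    using that by (cases x) (auto simp: cyc3_def split: if_splits)
  have "y \<in> {VA i, VA (nxt i), VA (prv i), VB i, VB (nxt i), VD}" "z \<in> {VA i, VA (nxt i), VA (prv i), VB i, VB (nxt i), VD}"
    "w \<in> {VA i, VA (nxt i), VA (prv i), VB i, VB (nxt i), VD}"
    using assms nbr unfolding some_null_def by blast+
  with assms(1) show ?thesis
    by (elim insertE emptyE; hypsubst; simp add: some_null_def cyc3_def)
      (simp_all only: F[simplified add_mset_commute nxt_prv prv_nxt] add_mset_commute)
qed

text \<open>With \<open>VC\<close> and \<open>VA\<close> treated before, only four neighbours of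
  \<open>VB i\<close> remain.\<close>

lemma P_clique_B:
  assumes "\<not> some_null (VB i) y z w" "i < m" "{y, z, w} \<inter> (range VC \<union> range VA) = {}"
  shows "P {#VB i, y, z, w#}"
proof -
  have i: "nxt i < m" "prv i < m"
    using assms by auto
  note F = P_clique_table[OF assms(2)] P_clique_table[OF i(1)] P_clique_table[OF i(2)]
    P_cube[of VB, OF _ assms(2), simplified insert_iff simp_thms] P_cube[of VB, OF _ i(1), simplified insert_iff simp_thms]
    P_cube[of VB, OF _ i(2), simplified insert_iff simp_thms]
  have nbr: "x \<in> {VB i, VB (nxt i), VB (prv i), VD}" if "third (VB i) x \<noteq> None" "x \<notin> range VC \<union> range VA" for x
    using that by (cases x) (auto simp: cyc3_def split: if_splits)
  have "y \<in> {VB i, VB (nxt i), VB (prv i), VD}" "z \<in> {VB i, VB (nxt i), VB (prv i), VD}"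
    "w \<in> {VB i, VB (nxt i), VB (prv i), VD}"
    by (rule nbr; use assms(1,3) in \<open>auto simp: some_null_def\<close>)+
  with assms(1) show ?thesis
    by (elim insertE emptyE; hypsubst; simp add: some_null_def cyc3_def)
      (simp_all only: F[simplified add_mset_commute nxt_prv prv_nxt] add_mset_commute)
qed

text \<open>When no pair is null, a factor of the first family present, in the order C, A, B, is
  brought to the front; the side conditions of the clique lemmas follow this order.\<close>

theorem P_all:
  assumes "{x, y, z, w} \<subseteq> V"
  shows "P {#x, y, z, w#}"
proof (cases "some_null x y z w")
  case False
  have perm: "\<not> some_null y x z w" "\<not> some_null z x y w" "\<not> some_null w x y z"
    using False by (auto simp: some_null_def third_commute)
  show ?thesis
  proof (cases "{x, y, z, w} \<inter> range VC = {}")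
    case False
    then consider i where "x = VC i" | i where "y = VC i" | i where "z = VC i" | i where "w = VC i"
      by auto
    then show ?thesis
      by cases (use \<open>\<not> some_null x y z w\<close> perm assms P_clique_C[of _ y z w] P_clique_C[of _ x z w] P_clique_C[of _ x y w] P_clique_C[of _ x y z]
          in \<open>auto simp: add_mset_commute\<close>)
  next
    case noC: True
    show ?thesis
    proof (cases "{x, y, z, w} \<inter> range VA = {}")
      case False
      then consider i where "x = VA i" | i where "y = VA i" | i where "z = VA i" | i where "w = VA i"
        by auto
      then show ?thesis
        by cases (use \<open>\<not> some_null x y z w\<close> perm assms noC P_clique_A[of _ y z w] P_clique_A[of _ x z w] P_clique_A[of _ x y w] P_clique_A[of _ x y z]
            in \<open>auto simp: add_mset_commute\<close>)
    next
      case noA: True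
      show ?thesis
      proof (cases x)
        case (VB i)
        then show ?thesis
          using P_clique_B[of i y z w] False assms noA noC by auto
      next
        case VD
        \<comment> \<open>Since the square of \<open>VD\<close> is null, the second factor must be
          some \<open>VB j\<close>.\<close>
        with False noA noC obtain j where "y = VB j"
          by (cases y) (auto simp: some_null_def)
        with perm assms noA noC P_clique_B[of j x z w] show ?thesis
          by (auto simp: add_mset_commute)
      qed (use noA noC in auto)
    qed
  qed
qed (use assms P_some_null in auto)

end

section \<open>The apolar algebra of the cubic\<close>

definition mset_exp :: "'x multiset \<Rightarrow> 'x monomial"
  where "mset_exp A = (\<Sum>x\<in>#A. Poly_Mapping.single x 1)"

definition mset_var :: "'x multiset \<Rightarrow> ('x, 'k::comm_ring_1) mpoly"
  where "mset_var A = Poly_Mapping.single (mset_exp A) 1"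

lemma mset_exp_empty [simp]: "mset_exp {#} = 0"
  and mset_exp_add: "mset_exp (A + B) = mset_exp A + mset_exp B"
  by (simp_all add: mset_exp_def)

lemma lookup_mset_exp [simp]: "Poly_Mapping.lookup (mset_exp A) x = count A x"
  by (induction A) (auto simp: mset_exp_def lookup_add lookup_single when_def)

lemma mset_exp_eq_iff [simp]: "mset_exp A = mset_exp B \<longleftrightarrow> A = B"
  by (metis lookup_mset_exp multiset_eqI)

lemma mset_exp_cases: obtains A where "\<mu> = mset_exp A"
proof
  show "\<mu> = mset_exp (\<Sum>x\<in>Poly_Mapping.keys \<mu>. replicate_mset (Poly_Mapping.lookup \<mu> x) x)"
    by (rule poly_mapping_eqI) (auto simp: count_sum in_keys_iff)
qed

lemma keys_mset_exp [simp]: "Poly_Mapping.keys (mset_exp A) = set_mset A"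
  by (auto simp: in_keys_iff)

lemma mdeg_mset_exp [simp]: "mdeg (mset_exp A) = size A"
  by (simp add: mdeg_def size_multiset_overloaded_eq)

lemma mset_exp_in_monomials [simp]: "mset_exp A \<in> monomials_in V \<longleftrightarrow> set_mset A \<subseteq> V"
  by (simp add: monomials_in_def)

lemma mset_var_mult: "mset_var A * mset_var B = mset_var (A + B)"
  by (simp add: mset_var_def mult_single mset_exp_add)

lemma var_eq_mset_var: "var x = mset_var {#x#}"
  by (simp add: var_def mset_var_def mset_exp_def)

lemma pairing_mset_var [simp]: "pairing (mset_var A) \<phi> = \<phi> (mset_exp A)"
  by (simp add: mset_var_def)

lemma lookup_mset_var: "Poly_Mapping.lookup (mset_var B) (mset_exp A) = of_bool (A = B)"
  by (auto simp: mset_var_def lookup_single when_def)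

lemma mset_var_carrier [simp]: "mset_var A \<in> carrier (poly_ring V) \<longleftrightarrow> set_mset A \<subseteq> V"
  by (simp add: mset_var_def carrier_poly_ring)

text \<open>Injectivity lets each term occur only once, so no multiplicities arise that could vanish
  in some characteristic.\<close>

lemma sum_of_bool_inj:
  assumes "finite S" "inj_on f S"
  shows "(\<Sum>i\<in>S. of_bool (a = f i) :: 'k::comm_ring_1) = of_bool (a \<in> f ` S)"
proof (cases "a \<in> f ` S")
  case True
  then obtain j where j: "j \<in> S" "a = f j" by auto
  then have "(\<Sum>i\<in>S. of_bool (a = f i) :: 'k) = (\<Sum>i\<in>S. if i = j then 1 else 0)"
    using assms by (intro sum.cong) (auto dest: inj_onD)
  with j True assms show ?thesis by simp
qed (auto intro!: sum.neutral)

lemma mset3_eq_iff: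
  "{#x, y, z#} = {#a, b, c#} \<longleftrightarrow> x = a \<and> (y = b \<and> z = c \<or> y = c \<and> z = b)
    \<or> x = b \<and> (y = a \<and> z = c \<or> y = c \<and> z = a) \<or> x = c \<and> (y = a \<and> z = b \<or> y = b \<and> z = a)"
  by (auto simp: add_eq_conv_ex)

section \<open>Coefficients of the cubic\<close>

context cyclic_index
begin

lemma cubic_eq:
  "cubic m = (\<Sum>i<m. mset_var {#VA i, VB i, VC i#} + mset_var {#VA i, VA (nxt i), VA (nxt i)#}
     + mset_var {#VB i, VB (nxt i), VB (nxt i)#} + mset_var {#VC i, VC (nxt i), VC (nxt i)#}
     + mset_var {#VA i, VB (nxt i), VD#})"
  unfolding cubic_def Let_def
  by (intro sum.cong refl) (simp add: var_eq_mset_var mset_var_mult power2_eq_square nxt_eq_mod add_mset_commute)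

abbreviation coeff :: "vars multiset \<Rightarrow> 'k::comm_ring_1"
  where "coeff A \<equiv> Poly_Mapping.lookup (cubic m) (mset_exp A)"

lemma coeff_eq:
  "coeff A = of_bool (A \<in> (\<lambda>i. {#VA i, VB i, VC i#}) ` {..<m}) + of_bool (A \<in> (\<lambda>i. {#VA i, VA (nxt i), VA (nxt i)#}) ` {..<m})
     + of_bool (A \<in> (\<lambda>i. {#VB i, VB (nxt i), VB (nxt i)#}) ` {..<m}) + of_bool (A \<in> (\<lambda>i. {#VC i, VC (nxt i), VC (nxt i)#}) ` {..<m})
     + of_bool (A \<in> (\<lambda>i. {#VA i, VB (nxt i), VD#}) ` {..<m})"
proof -
  have inj: "inj_on (\<lambda>i. {#VA i, VB i, VC i#}) {..<m}" "inj_on (\<lambda>i. {#VA i, VA (nxt i), VA (nxt i)#}) {..<m}"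
    "inj_on (\<lambda>i. {#VB i, VB (nxt i), VB (nxt i)#}) {..<m}" "inj_on (\<lambda>i. {#VC i, VC (nxt i), VC (nxt i)#}) {..<m}"
    "inj_on (\<lambda>i. {#VA i, VB (nxt i), VD#}) {..<m}"
    by (rule inj_onI, unfold mset3_eq_iff vars.inject vars.distinct simp_thms, (blast | force))+
  show ?thesis
    unfolding cubic_eq lookup_sum lookup_add lookup_mset_var sum.distrib
    by (simp only: sum_of_bool_inj[OF finite_lessThan inj(1)] sum_of_bool_inj[OF finite_lessThan inj(2)]
      sum_of_bool_inj[OF finite_lessThan inj(3)] sum_of_bool_inj[OF finite_lessThan inj(4)]
      sum_of_bool_inj[OF finite_lessThan inj(5)])
qed

lemma coeff_size: "size A \<noteq> 3 \<Longrightarrow> coeff A = 0"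
  by (auto simp: coeff_eq)

text \<open>Reindexing by the rotation turns C_i C_{i+1}^2 into C_{i-1} C_i^2, which suits the simp
  rules that prefer \<open>prv\<close>.\<close>

lemma image_nxt: "f ` {..<m} = (\<lambda>i. f (prv i)) ` {..<m}"
proof -
  have "prv ` {..<m} = {..<m}"
    using image_eqI[of _ prv "nxt _"] by force
  then show ?thesis
    by (metis image_image)
qed

text \<open>The bridge from the combinatorial \<open>third\<close> to the cubic: the five families
  of terms are disjoint, so at most one summand of \<open>coeff_eq\<close> is 1.\<close>

lemma coeff_mset3:
  "coeff {#x, y, z#} = of_bool (third x y = Some z \<and> x \<in> cubic_vars m \<and> y \<in> cubic_vars m)"
  unfolding coeff_eq image_nxt[of "\<lambda>i. {#VA i, VA (nxt i), VA (nxt i)#}"]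
    image_nxt[of "\<lambda>i. {#VB i, VB (nxt i), VB (nxt i)#}"] image_nxt[of "\<lambda>i. {#VC i, VC (nxt i), VC (nxt i)#}"]
  by (cases x; cases y; cases z) (auto simp: mset3_eq_iff image_iff cyc3_def Bex_def)

lemma coeff_mset3':
  assumes "{x, y} \<subseteq> cubic_vars m"
  shows "coeff {#z, x, y#} = of_bool (third x y = Some z)"
proof -
  have "{#z, x, y#} = {#x, y, z#}"
    by simp
  with assms coeff_mset3[of x y z] show ?thesis
    by (simp only:) simp
qed

lemma coeff_pair:
  assumes "{x, y} \<subseteq> cubic_vars m"
  shows "coeff (add_mset x (add_mset y A)) = (case third x y of None \<Rightarrow> 0 | Some z \<Rightarrow> of_bool (A = {#z#}))"
proof (cases "size A = 1")
  case True
  then obtain z where "A = {#z#}"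
    by (metis size_1_singleton_mset)
  then show ?thesis
    using assms coeff_mset3[of x y z] by (auto split: option.splits)
next
  case False
  with coeff_size[of "add_mset x (add_mset y A)"] show ?thesis
    by (auto split: option.splits)
qed

lemma coeff_triple:
  assumes "{x, y, z} \<subseteq> cubic_vars m"
  shows "coeff (add_mset x (add_mset y (add_mset z A))) = of_bool (A = {#} \<and> third x y = Some z)"
  using assms coeff_size[of "add_mset x (add_mset y (add_mset z A))"] coeff_mset3[of x y z]
  by (cases "A = {#}") auto

section \<open>Elements of the annihilator\<close>

definition I :: "(vars, 'k::field) mpoly set"
  where "I = Ann (cubic_vars m) (cubic m)"

lemma ideal_I: "ideal I (poly_ring (cubic_vars m))"
  unfolding I_def by (rule ideal_Ann)

lemma I_iff:
  "p \<in> I \<longleftrightarrow> p \<in> carrier (poly_ring (cubic_vars m)) \<and>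
    (\<forall>A. pairing p (\<lambda>\<nu>. Poly_Mapping.lookup (cubic m) (mset_exp A + \<nu>)) = 0)"
  unfolding I_def Ann_def contract_eq_0_iff by (auto intro: mset_exp_cases) (metis mset_exp_cases)

lemma null_in_I: "third x y = None \<Longrightarrow> {x, y} \<subseteq> cubic_vars m \<Longrightarrow> mset_var {#x, y#} \<in> I"
  by (simp add: I_iff coeff_pair flip: mset_exp_add)

lemma swap_in_I: "third x y = third z w \<Longrightarrow> {x, y, z, w} \<subseteq> cubic_vars m \<Longrightarrow> mset_var {#x, y#} - mset_var {#z, w#} \<in> I"
  by (simp add: I_iff coeff_pair carrier_diff pairing_diff flip: mset_exp_add)

lemma triple_in_I: "third x y \<noteq> Some z \<Longrightarrow> {x, y, z} \<subseteq> cubic_vars m \<Longrightarrow> mset_var {#x, y, z#} \<in> I"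
  by (simp add: I_iff coeff_triple flip: mset_exp_add)

lemma triple_swap_in_I:
  "third x y = Some z \<Longrightarrow> third x' y' = Some z' \<Longrightarrow> {x, y, z, x', y', z'} \<subseteq> cubic_vars m \<Longrightarrow>
    mset_var {#x, y, z#} - mset_var {#x', y', z'#} \<in> I"
  by (simp add: I_iff coeff_triple carrier_diff pairing_diff flip: mset_exp_add)

lemma large_in_I: "size A > 3 \<Longrightarrow> set_mset A \<subseteq> cubic_vars m \<Longrightarrow> mset_var A \<in> I"
  by (simp add: I_iff coeff_size flip: mset_exp_add)

lemma ex_third:
  assumes "w \<in> cubic_vars m"
  obtains x y where "third x y = Some w" "x \<in> cubic_vars m" "y \<in> cubic_vars m"
proof (cases w)
  case (VA i)
  then show thesis using assms that[of "VB i" "VC i"] by auto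
next
  case (VB i)
  then show thesis using assms that[of "VA i" "VC i"] by auto
next
  case (VC i)
  then show thesis using assms that[of "VA i" "VB i"] by auto
next
  case VD
  then show thesis using assms that[of "VA 0" "VB (nxt 0)"] m6 by auto
qed

text \<open>Chooses for each variable w a quadric that contracts the cubic to the dual of w. These
  quadrics form the basis in degree 2 and give the dual functionals in degree 1.\<close>

lemma ex_third_mset:
  "\<exists>A. \<forall>w\<in>cubic_vars m. \<exists>x y. A w = {#x, y#} \<and> third x y = Some w \<and> {x, y} \<subseteq> cubic_vars m"
  by (rule bchoice) (metis ex_third empty_subsetI insert_subset)

text \<open>If x and v are both of type \<open>VC\<close>, some \<open>VA k\<close> with another
  index works. Otherwise some \<open>VC k\<close> does, with k not adjacent to the index of a factor
  \<open>VC\<close>.\<close>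

lemma ex_null_common:
  assumes "{x, v} \<subseteq> cubic_vars m"
  obtains y where "third x y = None" "third v y = None" "y \<noteq> x" "y \<in> cubic_vars m"
proof -
  \<comment> \<open>The value 0 at \<open>VD\<close> is arbitrary, since \<open>VD\<close> is null
    with every \<open>VC k\<close>.\<close>
  define ind where "ind u = (case u of VA i \<Rightarrow> i | VB i \<Rightarrow> i | VC i \<Rightarrow> i | VD \<Rightarrow> 0)" for u
  consider i j where "x = VC i" "v = VC j" | "v \<notin> range VC" | "x \<notin> range VC"
    by auto
  then show thesis
  proof cases
    case 1
    obtain k where "k < m" "k \<notin> {i, j, i, i, i}"
      by (rule avoid5)
    with 1 show thesis
      by (intro that[of "VA k"]) auto
  next
    case 2
    obtain k where "k < m" "k \<notin> {ind x, nxt (ind x), prv (ind x), ind v, ind v}"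
      by (rule avoid5)
    with 2 show thesis
      by (intro that[of "VC k"]) (cases x; cases v; auto simp: ind_def cyc3_def)+
  next
    case 3
    obtain k where "k < m" "k \<notin> {ind v, nxt (ind v), prv (ind v), ind x, ind x}"
      by (rule avoid5)
    with 3 show thesis
      by (intro that[of "VC k"]) (cases x; cases v; auto simp: ind_def cyc3_def)+
  qed
qed

lemma finite_vars: "finite (cubic_vars m)"
  by (simp add: cubic_vars_def)

lemma sum_delta_const:
  assumes "x \<in> cubic_vars m"
  shows "(\<Sum>y\<in>cubic_vars m. const (if y = x then 1 else 0) * u y) = (u x :: (vars, 'k::field) mpoly)"
proof -
  have "(\<Sum>y\<in>cubic_vars m. const (if y = x then 1 else 0) * u y) = (\<Sum>y\<in>cubic_vars m. if y = x then u y else 0)"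
    by (intro sum.cong refl) (auto simp: const_def)
  then show ?thesis
    using assms finite_vars by simp
qed

lemma size_Suc_cases:
  assumes "size A = Suc n"
  obtains x B where "A = add_mset x B" "size B = n"
  using assms size_eq_Suc_imp_eq_union by fastforce

section \<open>The Hilbert function of the apolar algebra\<close>

lemma VABC0: "{VA 0, VB 0, VC 0} \<subseteq> cubic_vars m"
  using m6 by auto

lemma hilbert_I_0: "hilbert (cubic_vars m) (I :: (vars, 'k::field) mpoly set) 0 1"
proof -
  have "hilbert (cubic_vars m) (I :: (vars, 'k) mpoly set) 0 (card {()})"
  proof (rule hilbertI[where u = "\<lambda>_. mset_var {#}" and \<phi> = "\<lambda>_ \<nu>. Poly_Mapping.lookup (cubic m) (mset_exp {#VA 0, VB 0, VC 0#} + \<nu>)"])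
    fix \<mu> :: "vars monomial"
    assume "mdeg \<mu> = 0"
    then have "\<mu> = 0"
      by (cases rule: mset_exp_cases[of \<mu>]) simp
    then show "\<exists>c. Poly_Mapping.single \<mu> 1 - (\<Sum>x\<in>{()}. const (c x) * mset_var {#}) \<in> (I :: (vars, 'k) mpoly set)"
      by (intro exI[of _ "\<lambda>_. 1"]) (simp add: const_def mset_var_def mult_single ideal_zero[OF ideal_I])
  next
    show "pairing (mset_var {#} :: (vars, 'k) mpoly) (\<lambda>\<nu>. Poly_Mapping.lookup (cubic m) (mset_exp {#VA 0, VB 0, VC 0#} + \<nu>)) = (if x = y then 1 else 0)" for x y :: unit
      using VABC0 by (simp add: coeff_triple flip: mset_exp_add del: mset_exp_empty)
  qed (auto simp: ideal_I I_iff homogeneous_def mset_var_def carrier_single simp del: mset_exp_empty)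
  then show ?thesis
    by simp
qed

text \<open>The functional at x reads off the coefficient of the chosen quadric \<open>A x\<close>
  in the contraction of the cubic by p; for a variable p it is 1 exactly when p is x.\<close>

lemma hilbert_I_1: "hilbert (cubic_vars m) (I :: (vars, 'k::field) mpoly set) 1 (card (cubic_vars m))"
proof -
  obtain A where A: "\<forall>w\<in>cubic_vars m. \<exists>x y. A w = {#x, y#} \<and> third x y = Some w \<and> {x, y} \<subseteq> cubic_vars m"
    using ex_third_mset by blast
  show ?thesis
  proof (rule hilbertI[where u = "\<lambda>x. mset_var {#x#}" and \<phi> = "\<lambda>x \<nu>. Poly_Mapping.lookup (cubic m) (mset_exp (A x) + \<nu>)"])
    fix \<mu> :: "vars monomial"
    assume "\<mu> \<in> monomials_in (cubic_vars m)" "mdeg \<mu> = 1"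
    then obtain x where x: "\<mu> = mset_exp {#x#}" "x \<in> cubic_vars m"
      by (cases rule: mset_exp_cases[of \<mu>]) (auto elim!: size_Suc_cases)
    then show "\<exists>c. Poly_Mapping.single \<mu> 1 - (\<Sum>x\<in>cubic_vars m. const (c x) * mset_var {#x#}) \<in> (I :: (vars, 'k) mpoly set)"
      by (intro exI[of _ "\<lambda>y. if y = x then 1 else 0"]) (simp only: sum_delta_const, simp add: mset_var_def ideal_zero[OF ideal_I])
  next
    fix x y
    assume "x \<in> cubic_vars m" "y \<in> cubic_vars m"
    with bspec[OF A, of x] show "pairing (mset_var {#y#} :: (vars, 'k) mpoly) (\<lambda>\<nu>. Poly_Mapping.lookup (cubic m) (mset_exp (A x) + \<nu>)) = (if x = y then 1 else 0)"
      by (auto simp: coeff_mset3' simp flip: mset_exp_add)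
  qed (auto simp: ideal_I I_iff finite_vars homogeneous_def mset_var_def carrier_single)
qed

text \<open>The pairing of degree 1 with the roles exchanged. The chosen quadrics generate because
  monomials with the same third variable are congruent modulo I.\<close>

lemma hilbert_I_2: "hilbert (cubic_vars m) (I :: (vars, 'k::field) mpoly set) 2 (card (cubic_vars m))"
proof -
  obtain A where A: "\<forall>w\<in>cubic_vars m. \<exists>x y. A w = {#x, y#} \<and> third x y = Some w \<and> {x, y} \<subseteq> cubic_vars m"
    using ex_third_mset by blast
  show ?thesis
  proof (rule hilbertI[where u = "\<lambda>x. mset_var (A x)" and \<phi> = "\<lambda>x \<nu>. Poly_Mapping.lookup (cubic m) (mset_exp {#x#} + \<nu>)"])
    fix \<mu> :: "vars monomial"
    assume "\<mu> \<in> monomials_in (cubic_vars m)" "mdeg \<mu> = 2"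
    then obtain x y where xy: "\<mu> = mset_exp {#x, y#}" "{x, y} \<subseteq> cubic_vars m"
      by (cases rule: mset_exp_cases[of \<mu>]) (auto simp: numeral_2_eq_2 elim!: size_Suc_cases)
    show "\<exists>c. Poly_Mapping.single \<mu> 1 - (\<Sum>x\<in>cubic_vars m. const (c x) * mset_var (A x)) \<in> (I :: (vars, 'k) mpoly set)"
    proof (cases "third x y")
      case None
      with xy null_in_I[of x y] show ?thesis
        by (intro exI[of _ "\<lambda>_. 0"]) (simp add: mset_var_def const_def)
    next
      case (Some w)
      with xy have w: "w \<in> cubic_vars m"
        using third_in_V by auto
      then obtain x' y' where "A w = {#x', y'#}" "third x' y' = Some w" "{x', y'} \<subseteq> cubic_vars m"
        using A by blast
      with Some xy swap_in_I[of x y x' y'] have "mset_var {#x, y#} - mset_var (A w) \<in> (I :: (vars, 'k) mpoly set)"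
        by simp
      with xy w show ?thesis
        by (intro exI[of _ "\<lambda>y. if y = w then 1 else 0"]) (simp only: sum_delta_const, simp add: mset_var_def)
    qed
  next
    fix x y
    assume "x \<in> cubic_vars m" "y \<in> cubic_vars m"
    with bspec[OF A, of y] show "pairing (mset_var (A y) :: (vars, 'k) mpoly) (\<lambda>\<nu>. Poly_Mapping.lookup (cubic m) (mset_exp {#x#} + \<nu>)) = (if x = y then 1 else 0)"
      by (auto simp: coeff_mset3' simp flip: mset_exp_add)
  next
    fix x
    assume "x \<in> cubic_vars m"
    from bspec[OF A this] show "homogeneous 2 (mset_var (A x) :: (vars, 'k) mpoly)"
      "(mset_var (A x) :: (vars, 'k) mpoly) \<in> carrier (poly_ring (cubic_vars m))"
      by (auto simp: homogeneous_def mset_var_def carrier_single)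
  qed (auto simp: ideal_I I_iff finite_vars)
qed

text \<open>All terms of the cubic are congruent modulo I and the other monomials of degree 3 lie in
  I, so a_0 b_0 c_0 generates; the functional is the constant coefficient of the
  contraction.\<close>

lemma hilbert_I_3: "hilbert (cubic_vars m) (I :: (vars, 'k::field) mpoly set) 3 1"
proof -
  let ?t = "{#VA 0, VB 0, VC 0#}"
  have "hilbert (cubic_vars m) (I :: (vars, 'k) mpoly set) 3 (card {()})"
  proof (rule hilbertI[where u = "\<lambda>_. mset_var ?t" and \<phi> = "\<lambda>_ \<nu>. Poly_Mapping.lookup (cubic m) (mset_exp {#} + \<nu>)"])
    fix \<mu> :: "vars monomial"
    assume "\<mu> \<in> monomials_in (cubic_vars m)" "mdeg \<mu> = 3"
    then obtain x y z where xyz: "\<mu> = mset_exp {#x, y, z#}" "{x, y, z} \<subseteq> cubic_vars m"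
      by (cases rule: mset_exp_cases[of \<mu>]) (auto simp: numeral_3_eq_3 elim!: size_Suc_cases)
    show "\<exists>c. Poly_Mapping.single \<mu> 1 - (\<Sum>x\<in>{()}. const (c x) * mset_var ?t) \<in> (I :: (vars, 'k) mpoly set)"
    proof (cases "third x y = Some z")
      case False
      with xyz triple_in_I[of x y z] show ?thesis
        by (intro exI[of _ "\<lambda>_. 0"]) (simp add: mset_var_def const_def)
    next
      case True
      with xyz VABC0 triple_swap_in_I[of x y z "VA 0" "VB 0" "VC 0"] show ?thesis
        by (intro exI[of _ "\<lambda>_. 1"]) (simp add: mset_var_def const_def mult_single)
    qed
  next
    show "pairing (mset_var ?t :: (vars, 'k) mpoly) (\<lambda>\<nu>. Poly_Mapping.lookup (cubic m) (mset_exp {#} + \<nu>)) = (if x = y then 1 else 0)" for x y :: unit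
      using VABC0 by (simp add: coeff_triple)
  next
    show "homogeneous 3 (mset_var ?t :: (vars, 'k) mpoly)"
      by (simp add: homogeneous_def mset_var_def)
  qed (use VABC0 in \<open>auto simp: ideal_I I_iff simp del: mset_exp_empty\<close>)
  then show ?thesis
    by simp
qed

lemma hilbert_I_large:
  assumes "i > 3"
  shows "hilbert (cubic_vars m) (I :: (vars, 'k::field) mpoly set) i 0"
proof -
  have "hilbert (cubic_vars m) (I :: (vars, 'k) mpoly set) i (card ({} :: unit set))"
  proof (rule hilbertI)
    fix \<mu> :: "vars monomial"
    assume "\<mu> \<in> monomials_in (cubic_vars m)" "mdeg \<mu> = i"
    with assms show "\<exists>c. Poly_Mapping.single \<mu> 1 - (\<Sum>x\<in>({} :: unit set). const (c x) * 0) \<in> (I :: (vars, 'k) mpoly set)"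
      using large_in_I by (cases rule: mset_exp_cases[of \<mu>]) (auto simp: mset_var_def)
  qed (auto simp: ideal_I)
  then show ?thesis
    by simp
qed

section \<open>The square of the annihilator and the tangent functionals\<close>

definition I2 :: "(vars, 'k::field) mpoly set"
  where "I2 = I \<cdot>\<^bsub>poly_ring (cubic_vars m)\<^esub> I"

lemma ideal_I2: "ideal I2 (poly_ring (cubic_vars m))"
  unfolding I2_def by (rule ring.ideal_prod_is_ideal[OF ring_poly_ring ideal_I ideal_I])

lemma mult_in_I2: "p \<in> I \<Longrightarrow> q \<in> I \<Longrightarrow> p * q \<in> I2"
  unfolding I2_def using ideal_prod.prod[of p I q I "poly_ring (cubic_vars m)"] by simp

text \<open>
  The functional \<open>s \<mapsto> (\<partial>s/\<partial>x) F\<close> on monomials; the truncated exponent subtraction is harmless since the first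
  factor vanishes when \<open>x\<close> does not divide the monomial.
\<close>

definition tangent :: "vars \<Rightarrow> vars monomial \<Rightarrow> 'k::field"
  where "tangent x \<nu> = of_nat (Poly_Mapping.lookup \<nu> x) * Poly_Mapping.lookup (cubic m) (\<nu> - Poly_Mapping.single x 1)"

text \<open>The Leibniz rule on monomials. The exponent as a factor allows the truncated subtraction
  to be moved past the sum.\<close>

lemma tangent_add:
  "tangent x (\<alpha> + \<beta>) =
    of_nat (Poly_Mapping.lookup \<alpha> x) * Poly_Mapping.lookup (cubic m) (\<alpha> - Poly_Mapping.single x 1 + \<beta>)
    + of_nat (Poly_Mapping.lookup \<beta> x) * Poly_Mapping.lookup (cubic m) (\<beta> - Poly_Mapping.single x 1 + \<alpha>)"
proof -
  have sub: "\<gamma> - Poly_Mapping.single x 1 + \<delta> = \<gamma> + \<delta> - Poly_Mapping.single x 1"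
    if "Poly_Mapping.lookup \<gamma> x > 0" for \<gamma> \<delta> :: "vars monomial"
    using that by (intro poly_mapping_eqI) (auto simp: lookup_add lookup_minus lookup_single when_def)
  have eq: "of_nat (Poly_Mapping.lookup \<gamma> x) * Poly_Mapping.lookup (cubic m) (\<gamma> - Poly_Mapping.single x 1 + \<delta>)
      = (of_nat (Poly_Mapping.lookup \<gamma> x) * Poly_Mapping.lookup (cubic m) (\<gamma> + \<delta> - Poly_Mapping.single x 1) :: 'a)" for \<gamma> \<delta>
    using sub[of \<gamma> \<delta>] by (cases "Poly_Mapping.lookup \<gamma> x = 0") auto
  show ?thesis
    unfolding eq by (simp add: tangent_def lookup_add distrib_right add.commute[of \<beta> \<alpha>])
qed

lemma pairing_I: "p \<in> I \<Longrightarrow> pairing p (\<lambda>\<nu>. Poly_Mapping.lookup (cubic m) (\<mu> + \<nu>)) = 0"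
  by (auto simp: I_def Ann_def contract_eq_0_iff)

text \<open>By the Leibniz rule, each of the two summands for a product p q contracts the cubic by
  one undifferentiated factor, and both factors annihilate it.\<close>

lemma pairing_tangent:
  assumes "p \<in> (I2 :: (vars, 'k::field) mpoly set)"
  shows "pairing p (tangent x) = 0"
  using assms unfolding I2_def
proof (induction p rule: ideal_prod.induct)
  case (prod p q)
  have "pairing p (\<lambda>\<alpha>. of_nat (Poly_Mapping.lookup \<alpha> x) *
      pairing q (\<lambda>\<beta>. Poly_Mapping.lookup (cubic m) (\<alpha> - Poly_Mapping.single x 1 + \<beta>))) = 0"
    using prod by (simp add: pairing_I)
  moreover have "pairing p (\<lambda>\<alpha>. pairing q (\<lambda>\<beta>. of_nat (Poly_Mapping.lookup \<beta> x) *
      Poly_Mapping.lookup (cubic m) (\<beta> - Poly_Mapping.single x 1 + \<alpha>))) = 0"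
    using prod by (subst pairing_swap) (simp add: pairing_I pairing_fun_scale)
  ultimately show ?case
    by (simp add: pairing_mult tangent_add pairing_fun_add pairing_fun_scale)
qed (simp add: pairing_add)

lemma tangent_mset_exp: "tangent x (mset_exp A) = of_nat (count A x) * coeff (A - {#x#})"
proof -
  have "mset_exp A - Poly_Mapping.single x 1 = mset_exp (A - {#x#})"
    by (rule poly_mapping_eqI) (auto simp: lookup_minus lookup_single when_def)
  then show ?thesis
    by (simp add: tangent_def)
qed

text \<open>Removing x leaves the term y z w of the cubic. Removing y, z or w leaves no term,
  because x y is null and the third variable of z w is not x.\<close>

lemma tangent_start:
  assumes "third x y = None" "y \<noteq> x" "third z w = Some y" "{x, y, z, w} \<subseteq> cubic_vars m"
  shows "tangent v (mset_exp {#x, y, z, w#}) = (of_bool (v = x) :: 'k::field)"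
proof -
  have y: "third y z = Some w" "third y w = Some z"
    using assms third_rotate[of z w y] third_rotate[of w z y] by (simp_all add: third_commute)
  \<comment> \<open>So x has exponent exactly 1, and the value 1 below holds in every
    characteristic.\<close>
  then have "z \<noteq> x" "w \<noteq> x"
    using assms third_commute[of x y] by auto
  have "coeff {#y, z, w#} = (1 :: 'k)"
    using assms y by (simp add: coeff_mset3)
  moreover have "coeff {#x, z, w#} = (0 :: 'k)" "coeff {#x, y, w#} = (0 :: 'k)" "coeff {#x, y, z#} = (0 :: 'k)"
    using assms coeff_mset3'[of z w x] coeff_mset3[of x y w] coeff_mset3[of x y z] by auto
  ultimately show ?thesis
    using assms(2) \<open>z \<noteq> x\<close> \<open>w \<noteq> x\<close> by (auto simp: tangent_mset_exp)
qed

section \<open>Degrees 4 and 5 modulo the square of the annihilator\<close>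

definition reduced :: "(vars \<Rightarrow> (vars, 'k::field) mpoly) \<Rightarrow> (vars, 'k) mpoly \<Rightarrow> bool"
  where "reduced e p \<longleftrightarrow> (\<exists>c. p - (\<Sum>x\<in>cubic_vars m. const (c x) * e x) \<in> I2)"

lemma reduced_I2: "p \<in> I2 \<Longrightarrow> reduced e p"
  unfolding reduced_def by (intro exI[of _ "\<lambda>_. 0"]) (simp add: const_def)

lemma reduced_basis: "x \<in> cubic_vars m \<Longrightarrow> reduced e (e x)"
  unfolding reduced_def
  by (intro exI[of _ "\<lambda>y. if y = x then 1 else 0"]) (simp only: sum_delta_const, simp add: ideal_zero[OF ideal_I2])

lemma reduced_add:
  assumes "reduced e p" "reduced e q"
  shows "reduced e (p + q)"
proof -
  obtain c d where "p - (\<Sum>x\<in>cubic_vars m. const (c x) * e x) \<in> I2" "q - (\<Sum>x\<in>cubic_vars m. const (d x) * e x) \<in> I2"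
    using assms by (auto simp: reduced_def)
  from ideal_add[OF ideal_I2 this]
  have "p + q - (\<Sum>x\<in>cubic_vars m. const (c x + d x) * e x) \<in> I2"
    by (simp add: const_mult_add sum.distrib add_diff_add)
  then show ?thesis
    unfolding reduced_def by (intro exI[of _ "\<lambda>x. c x + d x"])
qed

lemma reduced_uminus:
  assumes "reduced e p"
  shows "reduced e (- p)"
proof -
  obtain c where "p - (\<Sum>x\<in>cubic_vars m. const (c x) * e x) \<in> I2"
    using assms by (auto simp: reduced_def)
  from ideal_uminus[OF ideal_I2 this]
  have "- p - (\<Sum>x\<in>cubic_vars m. const (- c x) * e x) \<in> I2"
    by (simp add: const_def single_uminus sum_negf)
  then show ?thesis
    unfolding reduced_def by (intro exI[of _ "\<lambda>x. - c x"])
qed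

lemma reduced_diff: "reduced e p \<Longrightarrow> reduced e q \<Longrightarrow> reduced e (p - q)"
  using reduced_add[of e p "- q"] reduced_uminus[of e q] by simp

text \<open>The three exchange rules are expansions of products of two elements of I: two null
  monomials, a null monomial and a difference, or two differences. Closure under sums and
  differences cancels the terms already known.\<close>

lemma quartic_rules_if_subspace:
  fixes N :: "(vars, 'k::field) mpoly \<Rightarrow> bool"
  assumes N: "\<And>p q. p \<in> I \<Longrightarrow> q \<in> I \<Longrightarrow> N (p * q)" "\<And>p q. N p \<Longrightarrow> N q \<Longrightarrow> N (p + q)" "\<And>p q. N p \<Longrightarrow> N q \<Longrightarrow> N (p - q)"
    and start: "\<And>x. x \<in> cubic_vars m \<Longrightarrow> \<exists>y z w. third x y = None \<and> y \<noteq> x \<and> third z w = Some y \<and>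
      {y, z, w} \<subseteq> cubic_vars m \<and> N (mset_var {#x, y, z, w#})"
  shows "quartic_rules m (\<lambda>A. N (mset_var A))"
proof
  have split: "mset_var {#x, y, z, w#} = mset_var {#x, y#} * (mset_var {#z, w#} :: (vars, 'k) mpoly)" for x y z w
    by (simp add: mset_var_mult add_mset_commute)
  {
    fix x y z w
    assume "third x y = None" "third z w = None" "{x, y, z, w} \<subseteq> cubic_vars m"
    then show "N (mset_var {#x, y, z, w#})"
      unfolding split by (intro N(1) null_in_I) auto
  next
    fix x y z w z' w'
    assume *: "third x y = None" "third z w \<noteq> None" "third z w = third z' w'" "{x, y, z, w, z', w'} \<subseteq> cubic_vars m"
      and "N (mset_var {#x, y, z', w'#})"
    moreover have "N (mset_var {#x, y#} * (mset_var {#z, w#} - mset_var {#z', w'#}))"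
      using * by (intro N(1) null_in_I swap_in_I) auto
    ultimately show "N (mset_var {#x, y, z, w#})"
      unfolding split using N(2) by (fastforce simp: algebra_simps)
  next
    fix x y x' y' z w z' w'
    assume *: "third x y \<noteq> None" "third x y = third x' y'" "third z w \<noteq> None" "third z w = third z' w'"
        "{x, y, x', y', z, w, z', w'} \<subseteq> cubic_vars m"
      and P: "N (mset_var {#x, y, z', w'#})" "N (mset_var {#x', y', z, w#})" "N (mset_var {#x', y', z', w'#})"
    let ?p = "mset_var {#x, y#}" and ?p' = "mset_var {#x', y'#}" and ?q = "mset_var {#z, w#}" and ?q' = "mset_var {#z', w'#} :: (vars, 'k) mpoly"
    have "N ((?p - ?p') * (?q - ?q'))"
      using * by (intro N(1) swap_in_I) auto
    then have "N ((?p - ?p') * (?q - ?q') + ?p * ?q' + ?p' * ?q - ?p' * ?q')"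
      using P unfolding split by (intro N(2,3))
    also have "(?p - ?p') * (?q - ?q') + ?p * ?q' + ?p' * ?q - ?p' * ?q' = ?p * ?q"
      by (simp add: algebra_simps)
    finally show "N (mset_var {#x, y, z, w#})"
      unfolding split .
  }
qed (use start m6 in auto)

text \<open>The degree 4 basis: to each x belongs a product of x with a term of the cubic containing
  a null partner y of x.\<close>

lemma start_exists:
  "\<exists>A. \<forall>x\<in>cubic_vars m. \<exists>y z w. A x = {#x, y, z, w#} \<and> third x y = None \<and> y \<noteq> x \<and> third z w = Some y \<and>
    {y, z, w} \<subseteq> cubic_vars m"
proof (rule bchoice, intro ballI)
  fix x
  assume "x \<in> cubic_vars m"
  then obtain y where y: "third x y = None" "y \<noteq> x" "y \<in> cubic_vars m"
    using ex_null_common[of x x] by auto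
  then obtain z w where "third z w = Some y" "z \<in> cubic_vars m" "w \<in> cubic_vars m"
    using ex_third by metis
  with y show "\<exists>A y z w. A = {#x, y, z, w#} \<and> third x y = None \<and> y \<noteq> x \<and> third z w = Some y \<and> {y, z, w} \<subseteq> cubic_vars m"
    by blast
qed

text \<open>\<open>P_all\<close> gives generation by the chosen monomials, and the functionals
  \<open>tangent x\<close> are dual to them and vanish on \<open>I2\<close>.\<close>

lemma hilbert_I2_4: "hilbert (cubic_vars m) (I2 :: (vars, 'k::field) mpoly set) 4 (card (cubic_vars m))"
proof -
  obtain A where A: "\<forall>x\<in>cubic_vars m. \<exists>y z w. A x = {#x, y, z, w#} \<and> third x y = None \<and> y \<noteq> x \<and>
      third z w = Some y \<and> {y, z, w} \<subseteq> cubic_vars m"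
    using start_exists by blast
  let ?e = "\<lambda>x. mset_var (A x) :: (vars, 'k) mpoly"
  interpret quartic_rules m "\<lambda>B. reduced ?e (mset_var B)"
  proof (rule quartic_rules_if_subspace)
    fix x
    assume x: "x \<in> cubic_vars m"
    with A obtain y z w where "A x = {#x, y, z, w#}" "third x y = None" "y \<noteq> x" "third z w = Some y" "{y, z, w} \<subseteq> cubic_vars m"
      by blast
    with reduced_basis[OF x, of ?e] show "\<exists>y z w. third x y = None \<and> y \<noteq> x \<and> third z w = Some y \<and>
      {y, z, w} \<subseteq> cubic_vars m \<and> reduced ?e (mset_var {#x, y, z, w#})"
      by auto
  qed (auto intro: reduced_I2 mult_in_I2 reduced_add reduced_diff)
  show ?thesis
  proof (rule hilbertI[where u = ?e and \<phi> = tangent])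
    fix \<mu> :: "vars monomial"
    assume "\<mu> \<in> monomials_in (cubic_vars m)" "mdeg \<mu> = 4"
    then obtain x y z w where xyzw: "\<mu> = mset_exp {#x, y, z, w#}" "{x, y, z, w} \<subseteq> cubic_vars m"
      by (cases rule: mset_exp_cases[of \<mu>]) (auto simp: eval_nat_numeral elim!: size_Suc_cases)
    from P_all[OF this(2)] xyzw(1) show "\<exists>c. Poly_Mapping.single \<mu> 1 - (\<Sum>x\<in>cubic_vars m. const (c x) * ?e x) \<in> I2"
      by (simp add: reduced_def mset_var_def)
  next
    fix x y
    assume "x \<in> cubic_vars m" "y \<in> cubic_vars m"
    with bspec[OF A, of y] tangent_start[where 'k = 'k] show "pairing (?e y) (tangent x) = (if x = y then 1 else 0)"
      by fastforce
  next
    fix x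
    assume "x \<in> cubic_vars m"
    with bspec[OF A this] show "homogeneous 4 (?e x)" "?e x \<in> carrier (poly_ring (cubic_vars m))"
      by (auto simp: homogeneous_def mset_var_def carrier_single)
  qed (auto simp: ideal_I2 finite_vars pairing_tangent)
qed

text \<open>For fixed v, the polynomials p with v p in \<open>I2\<close> form a subspace containing
  all products of two elements of I, so \<open>P_all\<close> reduces the claim to the start
  monomials.\<close>

lemma quintic_in_I2:
  assumes "v \<in> cubic_vars m" "{x, y, z, w} \<subseteq> cubic_vars m"
  shows "mset_var {#v, x, y, z, w#} \<in> (I2 :: (vars, 'k::field) mpoly set)"
proof -
  let ?N = "\<lambda>p. mset_var {#v#} * p \<in> (I2 :: (vars, 'k) mpoly set)"
  interpret quartic_rules m "\<lambda>B. ?N (mset_var B)"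
  proof (rule quartic_rules_if_subspace)
    fix x
    assume x: "x \<in> cubic_vars m"
    obtain y where y: "third x y = None" "third v y = None" "y \<noteq> x" "y \<in> cubic_vars m"
      using ex_null_common[of x v] x assms(1) by auto
    then obtain z w where zw: "third z w = Some y" "z \<in> cubic_vars m" "w \<in> cubic_vars m"
      using ex_third by metis
    \<comment> \<open>The first factor is a null pair; the second is not a term of the cubic because
      the third variable of z w is y, which differs from x.\<close>
    have "mset_var {#v, y#} * mset_var {#z, w, x#} \<in> (I2 :: (vars, 'k) mpoly set)"
      using x y zw assms by (intro mult_in_I2 null_in_I triple_in_I) auto
    then have "?N (mset_var {#x, y, z, w#})"
      by (simp add: mset_var_mult add_mset_commute)
    with y zw show "\<exists>y z w. third x y = None \<and> y \<noteq> x \<and> third z w = Some y \<and>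
      {y, z, w} \<subseteq> cubic_vars m \<and> ?N (mset_var {#x, y, z, w#})"
      by blast
  qed (use assms in \<open>auto simp: distrib_left right_diff_distrib
      intro: ideal_mult[OF ideal_I2] mult_in_I2 ideal_add[OF ideal_I2] ideal_diff[OF ideal_I2]\<close>)
  from P_all[OF assms(2)] show ?thesis
    by (simp add: mset_var_mult add_mset_commute)
qed

lemma hilbert_I2_5: "hilbert (cubic_vars m) (I2 :: (vars, 'k::field) mpoly set) 5 0"
proof -
  have "hilbert (cubic_vars m) (I2 :: (vars, 'k) mpoly set) 5 (card ({} :: unit set))"
  proof (rule hilbertI)
    fix \<mu> :: "vars monomial"
    assume "\<mu> \<in> monomials_in (cubic_vars m)" "mdeg \<mu> = 5"
    then obtain v x y z w where "\<mu> = mset_exp {#v, x, y, z, w#}" "{v, x, y, z, w} \<subseteq> cubic_vars m"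
      by (cases rule: mset_exp_cases[of \<mu>]) (auto simp: eval_nat_numeral elim!: size_Suc_cases)
    with quintic_in_I2[of v x y z w] show "\<exists>c. Poly_Mapping.single \<mu> 1 - (\<Sum>x\<in>({} :: unit set). const (c x) * 0) \<in> (I2 :: (vars, 'k) mpoly set)"
      by (simp add: mset_var_def)
  qed (auto simp: ideal_I2)
  then show ?thesis
    by simp
qed

section \<open>The small tangent space condition\<close>

lemma cubic_in_dual_space: "cubic m \<in> dual_space (cubic_vars m)"
proof -
  have "\<mu> \<in> monomials_in (cubic_vars m)" if "Poly_Mapping.lookup (cubic m) \<mu> \<noteq> (0 :: 'a)" for \<mu>
    using that by (cases rule: mset_exp_cases[of \<mu>]) (auto simp: coeff_eq of_bool_def split: if_splits)
  then show ?thesis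
    by (auto simp: dual_space_def in_keys_iff)
qed

lemma homogeneous_cubic: "homogeneous 3 (cubic m)"
proof -
  have "mdeg \<mu> = 3" if "Poly_Mapping.lookup (cubic m) \<mu> \<noteq> (0 :: 'a)" for \<mu>
    using that by (cases rule: mset_exp_cases[of \<mu>]) (metis coeff_size mdeg_mset_exp)
  then show ?thesis
    by (auto simp: homogeneous_def in_keys_iff)
qed

lemma has_hilbert_function_I:
  "has_hilbert_function (cubic_vars m) (I :: (vars, 'k::field) mpoly set) [1, card (cubic_vars m), card (cubic_vars m), 1]"
  unfolding has_hilbert_function_def
proof
  fix i :: nat
  consider "i = 0" | "i = 1" | "i = 2" | "i = 3" | "i > 3"
    by linarith
  then show "hilbert (cubic_vars m) (I :: (vars, 'k) mpoly set) i
    (if i < length [1, card (cubic_vars m), card (cubic_vars m), 1] then [1, card (cubic_vars m), card (cubic_vars m), 1] ! i else 0)"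
    using hilbert_I_0 hilbert_I_1 hilbert_I_2 hilbert_I_3 hilbert_I_large[of i]
    by cases (simp_all add: numeral_2_eq_2 numeral_3_eq_3)
qed

end

theorem proposition3p18:
  fixes m :: nat
  assumes "m \<ge> 6"
  shows "small_tangent_space (cubic_vars m) (dual_of (cubic m) :: (vars, 'k::field) dual)"
proof -
  interpret cyclic_index m
    by unfold_locales (rule assms)
  show ?thesis
    unfolding small_tangent_space_def dual_of_eq Let_def
    using finite_vars cubic_in_dual_space homogeneous_cubic has_hilbert_function_I hilbert_I2_4 hilbert_I2_5
    unfolding I2_def I_def by blast
qed

end
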